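(* Under an independent design (target design points $T_{ij}^{[t]}$ i.i.d. from a distribution $\eta_t$ on $[0,1]$, source design points $T_{ij}^{[s,k]}$ i.i.d. from a distribution $\eta_s$ on $[0,1]$), \[\inf_{\widehat f^{[t]}}\sup_{\mathbb P\in\mathcal P}\mathbb E\|\widehat f^{[t]}-f^{[t]}\|_{L^2}^2\gtrsim\Big[L_m^{\frac{2}{2\alpha_m+1}}(m_tn_t)^{-\frac{2\alpha_m}{2\alpha_m+1}}+\frac1{n_t}\Big]\wedge\Big[L_\delta^{\frac{2}{2\alpha_\delta+1}}(m_tn_t)^{-\frac{2\alpha_\delta}{2\alpha_\delta+1}}+\frac1{n_t}+L_m^{\frac{2}{2\alpha_m+1}}(Km_sn_s)^{-\frac{2\alpha_m}{2\alpha_m+1}}+\frac1{Kn_s}\Big],\] where the infimum is over all estimators $\widehat f^{[t]}=\widehat f^{[t]}(\mathcal D^{[t]},\mathcal D^{[s,1]},\dots,\mathcal D^{[s,K]})$.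
   Context: Model: target sample $\mathcal D^{[t]}=\{(T_{ij}^{[t]},Y_{ij}^{[t]}):j\le m_t,i\le n_t\}$, $Y_{ij}^{[t]}=X_i^{[t]}(T_{ij}^{[t]})+\epsilon_{ij}^{[t]}$; source samples $\mathcal D^{[s,k]}=\{(T_{ij}^{[s,k]},Y_{ij}^{[s,k]}):j\le m_s,i\le n_s\}$, $Y_{ij}^{[s,k]}=X_i^{[s,k]}(T_{ij}^{[s,k]})+\epsilon_{ij}^{[s,k]}$, $k=1,\dots,K$. Within each sample curves are i.i.d. copies of a random function $[0,1]\to\mathbb R$, noises are independent, identically distributed, independent of curves and design points; the $K+1$ samples are mutually independent. $f^{[t]}=\mathbb EX^{[t]}$, $f^{[s,k]}=\mathbb EX^{[s,k]}$, $\delta^{[s,k]}=f^{[t]}-f^{[s,k]}$. $\omega(\alpha)$ is the largest integer strictly smaller than $\alpha$; $\mathcal H_\alpha(L,M)$: $f:[0,1]\to\mathbb R$, $\|f\|_{L^\infty}\le M$, $\omega(\alpha)$-times continuously differentiable with $|f^{(\omega(\alpha))}(t_1)-f^{(\omega(\alpha))}(t_2)|\le L|t_1-t_2|^{\alpha-\omega(\alpha)}$. $\mathcal P$: distributions with $f^{[t]},f^{[s,k]}\in\mathcal H_{\alpha_m}(L_m,M_m)$, $\delta^{[s,k]}\in\mathcal H_{\alpha_\delta}(L_\delta,M_\delta)$ for all $k$, and for all $u>0,x,k$ each of $\mathbb P(|X_1^{[t]}(x)-f^{[t]}(x)|\ge u)$, $\mathbb P(|X_1^{[s,k]}(x)-f^{[s,k]}(x)|\ge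 u)$, $\mathbb P(|\epsilon_{11}^{[t]}|\ge u)$, $\mathbb P(|\epsilon_{11}^{[s,k]}|\ge u)$ is $\le2e^{-u^2/(2\tau^2)}$. $a\gtrsim b$: $a\ge cb$ with $c>0$ independent of $n_t,n_s,m_t,m_s,K$ (all other quantities are constants); $\wedge$: minimum. *)

theory Defs
  imports "HOL-Probability.Probability"
begin

definition omega_int :: "real \<Rightarrow> nat" where
  "omega_int \<alpha> = nat (\<lceil>\<alpha>\<rceil> - 1)"

definition hoelder :: "real \<Rightarrow> real \<Rightarrow> real \<Rightarrow> (real \<Rightarrow> real) \<Rightarrow> bool" where
  "hoelder \<alpha> L M f \<longleftrightarrow>
     (\<forall>x\<in>{0..1}. \<bar>f x\<bar> \<le> M) \<and>
     (\<exists>D :: nat \<Rightarrow> real \<Rightarrow> real.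
        (\<forall>x\<in>{0..1}. D 0 x = f x) \<and>
        (\<forall>k<omega_int \<alpha>. \<forall>x\<in>{0..1}.
            (D k has_real_derivative D (Suc k) x) (at x within {0..1})) \<and>
        continuous_on {0..1} (D (omega_int \<alpha>)) \<and>
        (\<forall>s\<in>{0..1}. \<forall>t\<in>{0..1}.
            \<bar>D (omega_int \<alpha>) s - D (omega_int \<alpha>) t\<bar>
              \<le> L * \<bar>s - t\<bar> powr (\<alpha> - real (omega_int \<alpha>))))"

text \<open>A random curve is X : Omega => [0,1] => R with Omega = (R, Borel, mu), jointly measurable.
  Its mean function f = E X.\<close>
definition mean_fun :: "real measure \<Rightarrow> (real \<Rightarrow> real \<Rightarrow> real) \<Rightarrow> real \<Rightarrow> real" where
  "mean_fun \<mu> X x = (\<integral>\<omega>. X \<omega> x \<partial>\<mu>)"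

definition valid_sample :: "real \<Rightarrow> real measure \<Rightarrow> (real \<Rightarrow> real \<Rightarrow> real) \<Rightarrow> real measure \<Rightarrow> bool" where
  "valid_sample \<tau> \<mu> X \<nu> \<longleftrightarrow>
     prob_space \<mu> \<and> sets \<mu> = sets borel \<and>
     (\<lambda>(\<omega>, x). X \<omega> x) \<in> borel_measurable (borel \<Otimes>\<^sub>M borel) \<and>
     (\<forall>x\<in>{0..1}. integrable \<mu> (\<lambda>\<omega>. X \<omega> x)) \<and>
     prob_space \<nu> \<and> sets \<nu> = sets borel \<and>
     integrable \<nu> (\<lambda>e. e) \<and> (\<integral>e. e \<partial>\<nu>) = 0 \<and>
     (\<forall>u>0. \<forall>x\<in>{0..1}.
        measure \<mu> {\<omega>. \<bar>X \<omega> x - mean_fun \<mu> X x\<bar> \<ge> u} \<le> 2 * exp (- (u\<^sup>2) / (2 * \<tau>\<^sup>2))) \<and>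
     (\<forall>u>0. measure \<nu> {e. \<bar>e\<bar> \<ge> u} \<le> 2 * exp (- (u\<^sup>2) / (2 * \<tau>\<^sup>2)))"

definition curve_obs :: "nat \<Rightarrow> real measure \<Rightarrow> real measure \<Rightarrow> (real \<Rightarrow> real \<Rightarrow> real)
    \<Rightarrow> real measure \<Rightarrow> (nat \<Rightarrow> real \<times> real) measure" where
  "curve_obs m \<eta> \<mu> X \<nu> =
     distr (\<mu> \<Otimes>\<^sub>M ((\<Pi>\<^sub>M j\<in>{..<m}. \<eta>) \<Otimes>\<^sub>M (\<Pi>\<^sub>M j\<in>{..<m}. \<nu>)))
           (\<Pi>\<^sub>M j\<in>{..<m}. (borel \<Otimes>\<^sub>M borel))
           (\<lambda>(\<omega>, t, e). \<lambda>j\<in>{..<m}. (t j, X \<omega> (t j) + e j))"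

definition sample_law :: "nat \<Rightarrow> nat \<Rightarrow> real measure \<Rightarrow> real measure \<Rightarrow> (real \<Rightarrow> real \<Rightarrow> real)
    \<Rightarrow> real measure \<Rightarrow> (nat \<Rightarrow> nat \<Rightarrow> real \<times> real) measure" where
  "sample_law n m \<eta> \<mu> X \<nu> = (\<Pi>\<^sub>M i\<in>{..<n}. curve_obs m \<eta> \<mu> X \<nu>)"

type_synonym model =
  "(real measure \<times> (real \<Rightarrow> real \<Rightarrow> real) \<times> real measure) \<times>
   ((nat \<Rightarrow> real measure) \<times> (nat \<Rightarrow> real \<Rightarrow> real \<Rightarrow> real) \<times> (nat \<Rightarrow> real measure))"

type_synonym data = "(nat \<Rightarrow> nat \<Rightarrow> real \<times> real) \<times> (nat \<Rightarrow> nat \<Rightarrow> nat \<Rightarrow> real \<times> real)"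

definition data_law :: "nat \<Rightarrow> nat \<Rightarrow> nat \<Rightarrow> nat \<Rightarrow> nat \<Rightarrow> real measure \<Rightarrow> real measure
    \<Rightarrow> model \<Rightarrow> data measure" where
  "data_law nt mt ns ms K \<eta>t \<eta>s P =
     (case P of ((\<mu>t, Xt, \<nu>t), (\<mu>s, Xs, \<nu>s)) \<Rightarrow>
        sample_law nt mt \<eta>t \<mu>t Xt \<nu>t \<Otimes>\<^sub>M
        (\<Pi>\<^sub>M k\<in>{..<K}. sample_law ns ms \<eta>s (\<mu>s k) (Xs k) (\<nu>s k)))"

definition data_space :: "nat \<Rightarrow> nat \<Rightarrow> nat \<Rightarrow> nat \<Rightarrow> nat \<Rightarrow> data measure" where
  "data_space nt mt ns ms K =
     (\<Pi>\<^sub>M i\<in>{..<nt}. \<Pi>\<^sub>M j\<in>{..<mt}. (borel \<Otimes>\<^sub>M borel)) \<Otimes>\<^sub>M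
     (\<Pi>\<^sub>M k\<in>{..<K}. \<Pi>\<^sub>M i\<in>{..<ns}. \<Pi>\<^sub>M j\<in>{..<ms}. (borel \<Otimes>\<^sub>M borel))"

definition model_class :: "nat \<Rightarrow> real \<Rightarrow> real \<Rightarrow> real \<Rightarrow> real \<Rightarrow> real \<Rightarrow> real \<Rightarrow> real
    \<Rightarrow> model set" where
  "model_class K \<alpha>m Lm Mm \<alpha>\<delta> L\<delta> M\<delta> \<tau> =
     {((\<mu>t, Xt, \<nu>t), (\<mu>s, Xs, \<nu>s)).
        valid_sample \<tau> \<mu>t Xt \<nu>t \<and>
        hoelder \<alpha>m Lm Mm (mean_fun \<mu>t Xt) \<and>
        (\<forall>k<K. valid_sample \<tau> (\<mu>s k) (Xs k) (\<nu>s k) \<and>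
               hoelder \<alpha>m Lm Mm (mean_fun (\<mu>s k) (Xs k)) \<and>
               hoelder \<alpha>\<delta> L\<delta> M\<delta> (\<lambda>x. mean_fun \<mu>t Xt x - mean_fun (\<mu>s k) (Xs k) x))}"

definition target_mean :: "model \<Rightarrow> real \<Rightarrow> real" where
  "target_mean P = (case P of ((\<mu>t, Xt, \<nu>t), _) \<Rightarrow> mean_fun \<mu>t Xt)"

definition risk :: "data measure \<Rightarrow> (data \<Rightarrow> real \<Rightarrow> real) \<Rightarrow> (real \<Rightarrow> real) \<Rightarrow> ennreal" where
  "risk Q g f = (\<integral>\<^sup>+ D. (\<integral>\<^sup>+ x\<in>{0..1}. ennreal ((g D x - f x)\<^sup>2) \<partial>lborel) \<partial>Q)"

end

theory Submission
  imports Defs "HOL-Computational_Algebra.Polynomial"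
begin

text \<open>The mean functions are sums of \<open>M\<close> disjoint bumps with signs \<open>\<plusminus>1\<close>, and Assouad's method
  reduces the lower bound to the affinity of data laws that differ in one sign. A sample hides a bump
  of amplitude \<open>A\<close> in one of two ways. With deterministic curves and Gaussian noise, flipping the sign in
  cell \<open>k\<close> costs about \<open>n m A\<^sup>2 \<eta>(cell k)\<close>, so the total over all cells is \<open>n m A\<^sup>2\<close> whatever the
  design distribution is. With noiseless curves made of independent biased coins, one per cell, it costs
  \<open>n A\<^sup>2\<close> however many points per curve are observed. Write \<open>a\<close> and \<open>a'\<close> for the nonparametric rates
  belonging to \<open>\<alpha>m\<close> and \<open>\<alpha>\<delta>\<close>, \<open>N = mt nt\<close> and \<open>N' = K ms ns\<close>. Choosing the modes of target and sources
  gives the lower bounds \<open>1/nt\<close>, \<open>min (a N) (a' N)\<close>, \<open>min (a N) (a N')\<close> and \<open>min (a N) (1/(K ns))\<close>, and up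
  to a constant the claimed minimum is at most the largest of these four.\<close>

text \<open>The obstacle is that \<open>\<eta>t\<close> and \<open>\<eta>s\<close> are arbitrary: a
  single cell may attract all design points, so the cost of one particular sign is not under
  control. Only the sum of the costs over all cells is, and Assouad's lemma is therefore used with a
  budget \<open>M / 2\<close> for that sum. Target and sources sit at the same vertex of the
  hypercube, and each side gets at most half of the budget. The source means are of one of two
  kinds. If they are zero, the difference function is the target mean itself and has to obey both
  smoothness conditions. If they equal the target mean, the difference function vanishes and only
  the smoothness of the means matters, but the sources then carry information that has to be hidden
  as well. Arbitrary designs and nested product laws are also the reason for a notion of closeness
  that needs no dominating measure.\<close>

subsection \<open>Hellinger affinity in variational form\<close>

text \<open>Variational form of \<open>squared Hellinger affinity \<ge> 1 - d\<close>: by Cauchy-Schwarz the squared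
  affinity of \<open>P\<close> and \<open>Q\<close> is the infimum of \<open>(\<integral>u dP) (\<integral>v dQ)\<close> over \<open>u v \<ge> 1\<close>. In this form,
  data processing and tensorization (with additive \<open>d\<close>) need no densities.\<close>

definition near :: "'a measure \<Rightarrow> 'a measure \<Rightarrow> real \<Rightarrow> bool" where
  "near P Q d \<longleftrightarrow> prob_space P \<and> prob_space Q \<and> sets P = sets Q \<and> 0 \<le> d \<and>
     (\<forall>u\<in>borel_measurable P. \<forall>v\<in>borel_measurable P.
        (\<forall>x\<in>space P. (1::ennreal) \<le> u x * v x) \<longrightarrow>
        ennreal (1 - d) \<le> (\<integral>\<^sup>+x. u x \<partial>P) * (\<integral>\<^sup>+x. v x \<partial>Q))"

lemma nearD:
  assumes "near P Q d" "u \<in> borel_measurable P" "v \<in> borel_measurable P"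
    "\<And>x. x \<in> space P \<Longrightarrow> (1::ennreal) \<le> u x * v x"
  shows "ennreal (1 - d) \<le> (\<integral>\<^sup>+x. u x \<partial>P) * (\<integral>\<^sup>+x. v x \<partial>Q)"
  using assms unfolding near_def by blast

lemma ennreal_power2_le_iff: "(a::ennreal)\<^sup>2 \<le> b\<^sup>2 \<longleftrightarrow> a \<le> b"
  by (cases a; cases b) (auto simp: ennreal_power ennreal_le_iff2 power2_nonneg_ge_1_iff top_unique
      power_eq_top_ennreal dest: power2_le_imp_le intro: power_mono)

definition ennsqrt :: "ennreal \<Rightarrow> ennreal" where
  "ennsqrt u = (if u = \<infinity> then \<infinity> else ennreal (sqrt (enn2real u)))"

lemma ennsqrt_power2 [simp]: "(ennsqrt u)\<^sup>2 = u"
proof (cases u)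
  case (real r)
  then have "(ennsqrt u)\<^sup>2 = ennreal ((sqrt r)\<^sup>2)"
    by (simp add: ennsqrt_def ennreal_power del: real_sqrt_pow2)
  with real show ?thesis by simp
qed (simp add: ennsqrt_def power2_eq_square)

lemma measurable_ennsqrt [measurable]: "ennsqrt \<in> borel_measurable borel"
  unfolding ennsqrt_def by measurable

text \<open>The easy half of the variational formula: it turns an affinity that can be computed from
  densities into a \<open>near\<close> statement. Densities are used only in such base
  cases.\<close>

lemma density_Cauchy_Schwarz:
  fixes p q u v :: "'a \<Rightarrow> ennreal"
  assumes [measurable]: "p \<in> borel_measurable M" "q \<in> borel_measurable M"
    "u \<in> borel_measurable M" "v \<in> borel_measurable M"
    and uv: "\<And>x. x \<in> space M \<Longrightarrow> 1 \<le> u x * v x"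
  shows "(\<integral>\<^sup>+x. ennsqrt (p x) * ennsqrt (q x) \<partial>M)\<^sup>2 \<le> (\<integral>\<^sup>+x. p x * u x \<partial>M) * (\<integral>\<^sup>+x. q x * v x \<partial>M)"
proof -
  have 1: "1 \<le> ennsqrt (u x) * ennsqrt (v x)" if "x \<in> space M" for x
    using uv[OF that] ennreal_power2_le_iff[of 1 "ennsqrt (u x) * ennsqrt (v x)"]
    by (simp add: power_mult_distrib)
  have "(\<integral>\<^sup>+x. ennsqrt (p x) * ennsqrt (q x) \<partial>M)\<^sup>2
     \<le> (\<integral>\<^sup>+x. (ennsqrt (p x) * ennsqrt (u x)) * (ennsqrt (q x) * ennsqrt (v x)) \<partial>M)\<^sup>2"
  proof (intro power_mono nn_integral_mono)
    fix x assume "x \<in> space M"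
    have "ennsqrt (p x) * ennsqrt (q x) * 1
        \<le> ennsqrt (p x) * ennsqrt (q x) * (ennsqrt (u x) * ennsqrt (v x))"
      using 1[OF \<open>x \<in> space M\<close>] by (intro mult_left_mono) auto
    then show "ennsqrt (p x) * ennsqrt (q x)
        \<le> ennsqrt (p x) * ennsqrt (u x) * (ennsqrt (q x) * ennsqrt (v x))"
      by (simp add: mult_ac)
  qed simp
  also have "\<dots> \<le> (\<integral>\<^sup>+x. (ennsqrt (p x) * ennsqrt (u x))\<^sup>2 \<partial>M) * (\<integral>\<^sup>+x. (ennsqrt (q x) * ennsqrt (v x))\<^sup>2 \<partial>M)"
    by (rule Cauchy_Schwarz_nn_integral) measurable
  finally show ?thesis by (simp add: power_mult_distrib)
qed

lemma near_refl:
  assumes "prob_space P" shows "near P P 0"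
  unfolding near_def
proof (intro conjI ballI impI)
  interpret prob_space P by fact
  fix u v :: "'a \<Rightarrow> ennreal" assume u: "u \<in> borel_measurable P" and v: "v \<in> borel_measurable P"
    and uv: "\<forall>x\<in>space P. 1 \<le> u x * v x"
  have "(\<integral>\<^sup>+x. ennsqrt 1 * ennsqrt 1 \<partial>P)\<^sup>2 \<le> (\<integral>\<^sup>+x. 1 * u x \<partial>P) * (\<integral>\<^sup>+x. 1 * v x \<partial>P)"
    using u v uv by (intro density_Cauchy_Schwarz) auto
  then show "ennreal (1 - 0) \<le> (\<integral>\<^sup>+x. u x \<partial>P) * (\<integral>\<^sup>+x. v x \<partial>P)"
    by (simp add: emeasure_space_1 power2_eq_square[symmetric])
qed (use assms in auto)

lemma near_distr:
  assumes near: "near P Q d" and f [measurable]: "f \<in> measurable P N"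
  shows "near (distr P N f) (distr Q N f) d"
proof -
  have s [measurable_cong]: "sets Q = sets P" and d: "0 \<le> d" and pq: "prob_space P" "prob_space Q"
    using near by (auto simp: near_def)
  have f': "f \<in> measurable Q N" by measurable
  show ?thesis
    unfolding near_def
  proof (intro conjI ballI impI)
    fix u v :: "'b \<Rightarrow> ennreal"
    assume "u \<in> borel_measurable (distr P N f)" "v \<in> borel_measurable (distr P N f)"
      and uv: "\<forall>x\<in>space (distr P N f). 1 \<le> u x * v x"
    then have [measurable]: "u \<in> borel_measurable N" "v \<in> borel_measurable N" by auto
    have "ennreal (1 - d) \<le> (\<integral>\<^sup>+x. u (f x) \<partial>P) * (\<integral>\<^sup>+x. v (f x) \<partial>Q)"
      using uv measurable_space[OF f] by (intro nearD[OF near]) auto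
    then show "ennreal (1 - d) \<le> (\<integral>\<^sup>+x. u x \<partial>distr P N f) * (\<integral>\<^sup>+x. v x \<partial>distr Q N f)"
      by (simp add: nn_integral_distr f')
  qed (use d prob_space.prob_space_distr[OF pq(1) f] prob_space.prob_space_distr[OF pq(2) f'] in auto)
qed

text \<open>Integrating out the second coordinate leaves \<open>U V \<ge> 1 - d'\<close> pointwise,
  so \<open>U / (1 - d')\<close> and \<open>V\<close> are admissible weights for the first pair of
  measures. The result \<open>(1 - d) (1 - d')\<close> is at least \<open>1 - (d + d')\<close>. If
  \<open>d\<close> or \<open>d'\<close> reaches 1, the left-hand side is 0 in
  \<open>ennreal\<close>.\<close>

lemma near_pair:
  assumes n1: "near P Q d" and n2: "near P' Q' d'"
  shows "near (P \<Otimes>\<^sub>M P') (Q \<Otimes>\<^sub>M Q') (d + d')"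
proof -
  have s [measurable_cong]: "sets Q = sets P" "sets Q' = sets P'" and d: "0 \<le> d" "0 \<le> d'"
    and pq: "prob_space P" "prob_space Q" "prob_space P'" "prob_space Q'"
    using n1 n2 by (auto simp: near_def)
  interpret P': prob_space P' by fact
  interpret Q': prob_space Q' by fact
  interpret P: prob_space P by fact
  interpret Q: prob_space Q by fact
  interpret pP: pair_prob_space P P' ..
  interpret pQ: pair_prob_space Q Q' ..
  have [measurable_cong]: "sets (Q \<Otimes>\<^sub>M Q') = sets (P \<Otimes>\<^sub>M P')" by (intro sets_pair_measure_cong s)
  show ?thesis
    unfolding near_def
  proof (intro conjI ballI impI)
    fix u v :: "'a \<times> 'b \<Rightarrow> ennreal"
    assume [measurable]: "u \<in> borel_measurable (P \<Otimes>\<^sub>M P')" "v \<in> borel_measurable (P \<Otimes>\<^sub>M P')"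
      and uv: "\<forall>x\<in>space (P \<Otimes>\<^sub>M P'). 1 \<le> u x * v x"
    define U where "U x = (\<integral>\<^sup>+y. u (x, y) \<partial>P')" for x
    define V where "V x = (\<integral>\<^sup>+y. v (x, y) \<partial>Q')" for x
    have [measurable]: "U \<in> borel_measurable P" "V \<in> borel_measurable P"
      unfolding U_def V_def by measurable
    have UV: "ennreal (1 - d') \<le> U x * V x" if "x \<in> space P" for x
      unfolding U_def V_def using that uv
      by (intro nearD[OF n2]) (auto simp: space_pair_measure)
    have "ennreal (1 - (d + d')) \<le> (\<integral>\<^sup>+x. U x \<partial>P) * (\<integral>\<^sup>+x. V x \<partial>Q)"
    proof (cases "d' < 1")
      case True
      have "ennreal (1 - d) \<le> (\<integral>\<^sup>+x. U x / ennreal (1 - d') \<partial>P) * (\<integral>\<^sup>+x. V x \<partial>Q)"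
      proof (intro nearD[OF n1])
        fix x assume "x \<in> space P"
        have "1 = ennreal (1 - d') / ennreal (1 - d')"
          using True by (simp add: ennreal_divide_self)
        also have "\<dots> \<le> (U x * V x) / ennreal (1 - d')"
          using UV[OF \<open>x \<in> space P\<close>] by (rule divide_right_mono_ennreal)
        finally show "1 \<le> U x / ennreal (1 - d') * V x"
          by (simp add: divide_ennreal_def mult_ac)
      qed measurable
      also have "\<dots> = (\<integral>\<^sup>+x. U x \<partial>P) * (\<integral>\<^sup>+x. V x \<partial>Q) / ennreal (1 - d')"
        by (simp add: nn_integral_divide) (simp add: divide_ennreal_def mult_ac)
      finally have "ennreal (1 - d) * ennreal (1 - d')
          \<le> ((\<integral>\<^sup>+x. U x \<partial>P) * (\<integral>\<^sup>+x. V x \<partial>Q)) / ennreal (1 - d') * ennreal (1 - d')"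
        by (rule mult_right_mono) simp
      also have "\<dots> = (\<integral>\<^sup>+x. U x \<partial>P) * (\<integral>\<^sup>+x. V x \<partial>Q)"
        using True by (intro ennreal_divide_times[THEN trans] ) (simp add: ennreal_divide_self)
      finally have *: "ennreal (1 - d) * ennreal (1 - d') \<le> (\<integral>\<^sup>+x. U x \<partial>P) * (\<integral>\<^sup>+x. V x \<partial>Q)" .
      show ?thesis
      proof (cases "d < 1")
        case dl: True
        have "ennreal (1 - (d + d')) \<le> ennreal ((1 - d) * (1 - d'))"
          using d by (intro ennreal_leI) (simp add: algebra_simps)
        also have "\<dots> = ennreal (1 - d) * ennreal (1 - d')"
          using dl True by (intro ennreal_mult) auto
        finally show ?thesis using * by (rule order_trans)
      qed (use d in \<open>auto simp: ennreal_neg\<close>)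
    qed (use d in \<open>auto simp: ennreal_neg\<close>)
    also have "(\<integral>\<^sup>+x. U x \<partial>P) = (\<integral>\<^sup>+x. u x \<partial>(P \<Otimes>\<^sub>M P'))"
      unfolding U_def by (rule P'.nn_integral_fst) measurable
    also have "(\<integral>\<^sup>+x. V x \<partial>Q) = (\<integral>\<^sup>+x. v x \<partial>(Q \<Otimes>\<^sub>M Q'))"
      unfolding V_def by (rule Q'.nn_integral_fst) measurable
    finally show "ennreal (1 - (d + d')) \<le> (\<integral>\<^sup>+x. u x \<partial>(P \<Otimes>\<^sub>M P')) * (\<integral>\<^sup>+x. v x \<partial>(Q \<Otimes>\<^sub>M Q'))" .
  qed (use d pP.prob_space_axioms pQ.prob_space_axioms s in \<open>auto cong: sets_pair_measure_cong\<close>)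
qed

lemma near_PiM:
  assumes "finite I" and near: "\<And>i. i \<in> I \<Longrightarrow> near (P i) (Q i) (d i)"
  shows "near (PiM I P) (PiM I Q) (\<Sum>i\<in>I. d i)"
  using assms
proof (induction I rule: finite_induct)
  case empty
  have "PiM {} P = PiM {} Q" by (rule PiM_cong) auto
  moreover have "prob_space (PiM {} Q)" by (rule prob_space_PiM) auto
  ultimately show ?case by (simp add: near_refl)
next
  case (insert i I)
  have pP: "prob_space (P j)" and pQ: "prob_space (Q j)" and s: "sets (P j) = sets (Q j)"
    if "j \<in> insert i I" for j
    using insert.prems[OF that] by (auto simp: near_def)
  have n: "near (P i \<Otimes>\<^sub>M PiM I P) (Q i \<Otimes>\<^sub>M PiM I Q) (d i + (\<Sum>i\<in>I. d i))"
    by (intro near_pair insert) auto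
  have m: "(\<lambda>(x, X). X(i := x)) \<in> measurable (P i \<Otimes>\<^sub>M PiM I P) (PiM (insert i I) P)"
    by measurable
  have "distr (Q i \<Otimes>\<^sub>M PiM I Q) (PiM (insert i I) P) (\<lambda>(x, X). X(i := x))
      = distr (Q i \<Otimes>\<^sub>M PiM I Q) (PiM (insert i I) Q) (\<lambda>(x, X). X(i := x))"
    using s by (intro distr_cong sets_PiM_cong) auto
  then show ?case
    using near_distr[OF n m] insert.hyps pP pQ by (simp add: distr_pair_PiM_eq_PiM)
qed

text \<open>Le Cam's two-point bound: apply the variational inequality to the weights
  \<open>u = l + (4/l) S\<close> and \<open>v = l + (4/l) T\<close>, where \<open>l\<^sup>2 = (1 - d)/4\<close>.\<close>

lemma near_two_point:
  assumes near: "near P Q d" and [measurable]: "S \<in> borel_measurable P" "T \<in> borel_measurable P"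
    and ST: "\<And>x. x \<in> space P \<Longrightarrow> ennreal (1/4) \<le> S x \<or> ennreal (1/4) \<le> T x"
  shows "ennreal ((1 - d) / 16) \<le> (\<integral>\<^sup>+x. S x \<partial>P) + (\<integral>\<^sup>+x. T x \<partial>Q)"
proof (cases "d < 1")
  case False
  then show ?thesis by (simp add: ennreal_neg)
next
  case True
  have [measurable_cong]: "sets Q = sets P" and pq: "prob_space P" "prob_space Q"
    using near by (auto simp: near_def)
  interpret P: prob_space P by fact
  interpret Q: prob_space Q by fact
  define l where "l = sqrt (1 - d) / 2"
  have l: "0 < l" "l\<^sup>2 = (1 - d) / 4" using True by (auto simp: l_def power_divide)
  \<comment> \<open>Both weights are at least \<open>l\<close>, and the one whose loss reaches 1/4
    is at least \<open>1 / l\<close>.\<close>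
  have key: "1 \<le> (ennreal l + ennreal (4 / l) * a) * (ennreal l + ennreal (4 / l) * b)"
    if "ennreal (1/4) \<le> a" for a b
  proof -
    have "1 = ennreal (4 / l) * ennreal (1/4) * ennreal l"
      using l by (simp flip: ennreal_mult)
    also have "\<dots> \<le> (ennreal l + ennreal (4 / l) * a) * (ennreal l + ennreal (4 / l) * b)"
      using that by (intro mult_mono add_increasing add_increasing2 mult_left_mono) auto
    finally show ?thesis .
  qed
  have "ennreal (1 - d) \<le> (\<integral>\<^sup>+x. ennreal l + ennreal (4 / l) * S x \<partial>P) * (\<integral>\<^sup>+x. ennreal l + ennreal (4 / l) * T x \<partial>Q)"
  proof (rule nearD[OF near])
    fix x assume "x \<in> space P"
    from ST[OF this] show "1 \<le> (ennreal l + ennreal (4 / l) * S x) * (ennreal l + ennreal (4 / l) * T x)"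
      using key[of "S x" "T x"] key[of "T x" "S x"] by (auto simp: mult.commute)
  qed measurable
  also have "\<dots> = (ennreal l + ennreal (4 / l) * (\<integral>\<^sup>+x. S x \<partial>P)) * (ennreal l + ennreal (4 / l) * (\<integral>\<^sup>+x. T x \<partial>Q))"
    by (simp add: nn_integral_add nn_integral_cmult P.emeasure_space_1 Q.emeasure_space_1)
  finally have main: "ennreal (1 - d) \<le> (ennreal l + ennreal (4 / l) * (\<integral>\<^sup>+x. S x \<partial>P)) * (ennreal l + ennreal (4 / l) * (\<integral>\<^sup>+x. T x \<partial>Q))" .
  show ?thesis
  proof (cases "(\<integral>\<^sup>+x. S x \<partial>P) = \<top> \<or> (\<integral>\<^sup>+x. T x \<partial>Q) = \<top>")
    case False
    then obtain a b where ab: "0 \<le> a" "0 \<le> b" "(\<integral>\<^sup>+x. S x \<partial>P) = ennreal a" "(\<integral>\<^sup>+x. T x \<partial>Q) = ennreal b"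
      by (metis ennreal_cases)
    have "ennreal ((l + 4 / l * a) * (l + 4 / l * b))
        = (ennreal l + ennreal (4 / l) * ennreal a) * (ennreal l + ennreal (4 / l) * ennreal b)"
      using ab l by (subst ennreal_mult; (subst ennreal_plus)?; (subst ennreal_plus)?; (subst ennreal_mult)?; (subst ennreal_mult)?; simp)
    then have "ennreal (1 - d) \<le> ennreal ((l + 4 / l * a) * (l + 4 / l * b))"
      using main ab by simp
    then have "1 - d \<le> (l + 4 / l * a) * (l + 4 / l * b)"
      using ab l by (subst (asm) ennreal_le_iff) (auto intro!: mult_nonneg_nonneg add_nonneg_nonneg)
    also have "\<dots> \<le> (l + 4 / l * (a + b)) * (l + 4 / l * (a + b))"
      using ab l by (intro mult_mono add_mono mult_left_mono) (auto intro!: mult_nonneg_nonneg add_nonneg_nonneg)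
    \<comment> \<open>Since \<open>1 - d = (2 * l)\<^sup>2\<close>, square roots can be compared;
      then \<open>l\<^sup>2 \<le> 4 * (a + b)\<close>, that is,
      \<open>a + b \<ge> (1 - d) / 16\<close>.\<close>
    finally have 1: "(2 * l)\<^sup>2 \<le> (l + 4 / l * (a + b))\<^sup>2"
      using l by (simp add: power2_eq_square)
    then have "2 * l \<le> l + 4 / l * (a + b)"
      using ab l by (intro power2_le_imp_le[OF 1]) (auto intro!: mult_nonneg_nonneg add_nonneg_nonneg)
    then have "l \<le> 4 * (a + b) / l" by simp
    then have "l\<^sup>2 \<le> 4 * (a + b)" using l by (simp add: power2_eq_square pos_le_divide_eq)
    then show ?thesis using l ab by (simp flip: ennreal_plus)
  qed auto
qed

subsection \<open>Bump functions\<close>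

text \<open>The \<open>j\<close>-th derivative of the bump \<open>(u (1 - u)) ^ p\<close> on the unit interval.\<close>

definition hat :: "nat \<Rightarrow> nat \<Rightarrow> real poly" where
  "hat p j = (pderiv ^^ j) ([:0, 1, -1:] ^ p)"

lemma poly_hat_0: "poly (hat p 0) u = (u * (1 - u)) ^ p"
  by (simp add: hat_def algebra_simps)

lemma power_dvd_pderiv:
  fixes q r :: "real poly"
  assumes "q ^ Suc n dvd r" shows "q ^ n dvd pderiv r"
proof -
  from assms obtain s where r: "r = q ^ Suc n * s" by (elim dvdE)
  show ?thesis
    unfolding r pderiv_mult pderiv_power_Suc
    by (intro dvd_add dvd_mult2[OF le_imp_power_dvd] dvd_mult[OF dvd_mult2[OF dvd_smult]]) auto
qed

lemma hat_dvd: "j \<le> p \<Longrightarrow> [:0, 1, -1:] ^ (p - j) dvd hat p j"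
proof (induction j)
  case (Suc j)
  then have "[:0, 1, -1:] ^ Suc (p - Suc j) dvd hat p j" by (simp add: Suc_diff_Suc)
  from power_dvd_pderiv[OF this] show ?case by (simp add: hat_def)
qed (simp add: hat_def)

lemma poly_bounded_unit:
  fixes r :: "real poly"
  obtains C where "0 \<le> C" "\<And>u. u \<in> {0..1} \<Longrightarrow> \<bar>poly r u\<bar> \<le> C"
proof -
  have "compact (poly r ` {0..1})" by (intro compact_continuous_image continuous_intros) simp
  then obtain C where "\<forall>x\<in>poly r ` {0..1}. norm x \<le> C"
    using compact_imp_bounded bounded_iff by metis
  then show ?thesis by (intro that[of "\<bar>C\<bar>"]) force+
qed

text \<open>Each differentiation of \<open>q ^ p\<close> removes at most one factor
  \<open>q\<close>, so two factors \<open>u (1 - u)\<close> survive. Vanishing to second order at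
  both ends lets neighbouring bumps with different coefficients fit together.\<close>

lemma hat_quadratic_at_ends:
  assumes "j + 2 \<le> p"
  obtains C where "0 \<le> C" "\<And>u. u \<in> {0..1} \<Longrightarrow> \<bar>poly (hat p j) u\<bar> \<le> C * (u * (1 - u))\<^sup>2"
proof -
  have "[:0, 1, -1::real:] ^ 2 dvd [:0, 1, -1:] ^ (p - j)"
    using assms by (intro le_imp_power_dvd) auto
  also have "\<dots> dvd hat p j" using assms by (intro hat_dvd) auto
  finally obtain s where s: "hat p j = [:0, 1, -1:] ^ 2 * s" by (elim dvdE)
  obtain C where C: "0 \<le> C" "\<And>u. u \<in> {0..1} \<Longrightarrow> \<bar>poly s u\<bar> \<le> C" using poly_bounded_unit[of s] by blast
  show ?thesis
  proof (rule that[OF C(1)])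
    fix u :: real assume "u \<in> {0..1}"
    have "poly (hat p j) u = (u * (1 - u))\<^sup>2 * poly s u"
      by (simp add: s algebra_simps)
    then show "\<bar>poly (hat p j) u\<bar> \<le> C * (u * (1 - u))\<^sup>2"
      using C(2)[OF \<open>u \<in> {0..1}\<close>] by (simp add: abs_mult mult_left_mono mult.commute[of C])
  qed
qed

text \<open>The \<open>j\<close>-th derivative (for \<open>j < p\<close>) of the sum of unit bumps on the cells \<open>[k, k + 1)\<close>
  with coefficients \<open>\<theta> k\<close>.\<close>

definition bumps :: "nat \<Rightarrow> nat \<Rightarrow> (int \<Rightarrow> real) \<Rightarrow> real \<Rightarrow> real" where
  "bumps p j \<theta> y = \<theta> \<lfloor>y\<rfloor> * poly (hat p j) (frac y)"

lemma frac_unit: "frac y \<in> {0..1}" for y :: real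
  using frac_ge_0[of y] frac_lt_1[of y] by auto

lemma bumps_bounded:
  obtains C where "0 < C" "\<And>\<theta> y. (\<And>k. \<bar>\<theta> k\<bar> \<le> 1) \<Longrightarrow> \<bar>bumps p j \<theta> y\<bar> \<le> C"
proof -
  obtain C where C: "0 \<le> C" "\<And>u. u \<in> {0..1} \<Longrightarrow> \<bar>poly (hat p j) u\<bar> \<le> C" using poly_bounded_unit[of "hat p j"] by blast
  show ?thesis
  proof (rule that[of "C + 1"])
    fix \<theta> :: "int \<Rightarrow> real" and y assume "\<And>k. \<bar>\<theta> k\<bar> \<le> 1"
    then have "\<bar>\<theta> \<lfloor>y\<rfloor>\<bar> * \<bar>poly (hat p j) (frac y)\<bar> \<le> 1 * C"
      using C frac_unit by (intro mult_mono) auto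
    then show "\<bar>bumps p j \<theta> y\<bar> \<le> C + 1" by (simp add: bumps_def abs_mult)
  qed (use C in auto)
qed

text \<open>Inside a cell the function is a polynomial. At an integer it vanishes to second order
  from both sides, so the difference quotient is \<open>O(h)\<close> and tends to 0. The margin 3 in
  \<open>j + 3 \<le> p\<close> makes the next derivative vanish there too.\<close>

lemma bumps_has_derivative:
  assumes "j + 3 \<le> p"
  shows "(bumps p j \<theta> has_real_derivative bumps p (Suc j) \<theta> y) (at y)"
proof (cases "y \<in> \<int>")
  case False
  let ?k = "\<lfloor>y\<rfloor>"
  have y: "y \<in> {real_of_int ?k<..<real_of_int ?k + 1}"
    using False of_int_floor_le[of y] floor_correct[of y] by (auto simp: less_le)
  have "((\<lambda>z. \<theta> ?k * poly (hat p j) (z - of_int ?k)) has_real_derivative \<theta> ?k * poly (hat p (Suc j)) (y - of_int ?k)) (at y)"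
    by (auto intro!: derivative_eq_intros simp: hat_def)
  moreover have "\<theta> ?k * poly (hat p (Suc j)) (y - of_int ?k) = bumps p (Suc j) \<theta> y"
    by (simp add: bumps_def frac_def)
  moreover have "\<theta> ?k * poly (hat p j) (z - of_int ?k) = bumps p j \<theta> z"
    if "z \<in> {real_of_int ?k<..<real_of_int ?k + 1}" for z
  proof -
    from that have "\<lfloor>z\<rfloor> = ?k" by (intro floor_unique) auto
    then show ?thesis by (simp add: bumps_def frac_def)
  qed
  ultimately show ?thesis
    using y by (auto intro: has_field_derivative_transform_within_open[of _ _ _ "{real_of_int ?k<..<real_of_int ?k + 1}"])
next
  case True
  then obtain k :: int where k: "y = of_int k" by (elim Ints_cases)
  obtain C where C: "0 \<le> C" "\<And>u. u \<in> {0..1} \<Longrightarrow> \<bar>poly (hat p j) u\<bar> \<le> C * (u * (1 - u))\<^sup>2"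
    using hat_quadratic_at_ends[of j p] assms by auto
  obtain C' where C': "0 \<le> C'" "\<And>u. u \<in> {0..1} \<Longrightarrow> \<bar>poly (hat p (Suc j)) u\<bar> \<le> C' * (u * (1 - u))\<^sup>2"
    using hat_quadratic_at_ends[of "Suc j" p] assms by auto
  have z0: "bumps p j \<theta> y = 0" "bumps p (Suc j) \<theta> y = 0"
    using C(2)[of 0] C'(2)[of 0] by (simp_all add: bumps_def k)
  let ?K = "C * (\<bar>\<theta> k\<bar> + \<bar>\<theta> (k - 1)\<bar>)"
  have bound: "\<bar>bumps p j \<theta> z\<bar> \<le> ?K * (z - y)\<^sup>2" if "\<bar>z - y\<bar> < 1" for z
  proof -
    have fl: "\<lfloor>z\<rfloor> = k \<or> \<lfloor>z\<rfloor> = k - 1" using that k by linarith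
    \<comment> \<open>Near the integer \<open>y\<close>, one of the two factors is the distance to
      \<open>y\<close> and the other is at most 1.\<close>
    have "\<bar>frac z * (1 - frac z)\<bar> \<le> \<bar>z - y\<bar>"
    proof -
      have f: "0 \<le> frac z" "frac z < 1" by (auto simp: frac_ge_0 frac_lt_1)
      have "frac z = z - y \<or> 1 - frac z = y - z" using fl k by (auto simp: frac_def)
      then show ?thesis
      proof
        assume "frac z = z - y"
        moreover have "frac z * (1 - frac z) \<le> frac z * 1" using f by (intro mult_left_mono) auto
        ultimately show ?thesis using f by (auto simp: abs_mult)
      next
        assume "1 - frac z = y - z"
        moreover have "frac z * (1 - frac z) \<le> 1 * (1 - frac z)" using f by (intro mult_right_mono) auto
        ultimately show ?thesis using f by (auto simp: abs_mult)
      qed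
    qed
    then have "(frac z * (1 - frac z))\<^sup>2 \<le> (z - y)\<^sup>2"
      by (metis abs_ge_zero power2_abs power_mono)
    then have "\<bar>poly (hat p j) (frac z)\<bar> \<le> C * (z - y)\<^sup>2"
      using C(2)[OF frac_unit, of z] C(1) by (meson mult_left_mono order_trans)
    moreover have "\<bar>\<theta> \<lfloor>z\<rfloor>\<bar> \<le> \<bar>\<theta> k\<bar> + \<bar>\<theta> (k - 1)\<bar>" using fl by auto
    ultimately have "\<bar>\<theta> \<lfloor>z\<rfloor>\<bar> * \<bar>poly (hat p j) (frac z)\<bar> \<le> (\<bar>\<theta> k\<bar> + \<bar>\<theta> (k - 1)\<bar>) * (C * (z - y)\<^sup>2)"
      by (intro mult_mono) auto
    then show ?thesis by (simp add: bumps_def abs_mult mult_ac)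
  qed
  have "((\<lambda>h. (bumps p j \<theta> (y + h) - bumps p j \<theta> y) / h) \<longlongrightarrow> 0) (at 0)"
  proof (rule Lim_null_comparison)
    have "\<forall>\<^sub>F h in at 0. \<bar>h\<bar> < (1::real) \<and> h \<noteq> 0"
      unfolding eventually_at by (intro exI[of _ 1]) auto
    then show "\<forall>\<^sub>F h in at 0. norm ((bumps p j \<theta> (y + h) - bumps p j \<theta> y) / h) \<le> ?K * \<bar>h\<bar>"
    proof eventually_elim
      case (elim h)
      have "\<bar>bumps p j \<theta> (y + h)\<bar> \<le> ?K * h\<^sup>2" using bound[of "y + h"] elim by simp
      then have "\<bar>bumps p j \<theta> (y + h)\<bar> / \<bar>h\<bar> \<le> ?K * h\<^sup>2 / \<bar>h\<bar>" by (intro divide_right_mono) auto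
      also have "\<dots> = ?K * \<bar>h\<bar>" using elim by (simp add: power2_eq_square abs_if)
      finally show ?case by (simp add: z0)
    qed
    show "((\<lambda>h. ?K * \<bar>h\<bar>) \<longlongrightarrow> 0) (at 0)"
      by (auto intro!: tendsto_eq_intros)
  qed
  then show ?thesis by (simp add: DERIV_def z0)
qed

text \<open>On the unit scale the derivative of order \<open>omega_int \<alpha>\<close> is bounded
  and Lipschitz, uniformly in the signs; rescaling by \<open>M\<close> multiplies its Hoelder
  constant by \<open>M powr \<alpha>\<close>. That \<open>B\<close> is independent of
  \<open>M\<close> matters because \<open>M\<close> grows with the sample sizes.\<close>

lemma hoelder_bumps:
  assumes "0 < \<alpha>" and p: "omega_int \<alpha> + 3 \<le> p"
  obtains B where "0 < B"
    "\<And>M A L Mx \<theta>. 1 \<le> M \<Longrightarrow> 0 \<le> A \<Longrightarrow> (\<And>k. \<bar>\<theta> k\<bar> \<le> 1) \<Longrightarrow> A * real M powr \<alpha> * B \<le> L \<Longrightarrow> A * B \<le> Mx \<Longrightarrow>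
       hoelder \<alpha> L Mx (\<lambda>x. A * bumps p 0 \<theta> (real M * x))"
proof -
  define w where "w = omega_int \<alpha>"
  define \<gamma> where "\<gamma> = \<alpha> - real w"
  \<comment> \<open>The exponent can be 1 but not 0, as \<open>omega_int\<close> stays strictly
    below \<open>\<alpha>\<close>.\<close>
  have \<gamma>: "0 < \<gamma>" "\<gamma> \<le> 1"
    using assms(1) unfolding \<gamma>_def w_def omega_int_def by linarith+
  obtain B0 where B0: "0 < B0" "\<And>\<theta> y. (\<And>k. \<bar>\<theta> k\<bar> \<le> 1) \<Longrightarrow> \<bar>bumps p w \<theta> y\<bar> \<le> B0"
    using bumps_bounded[of p w] by blast
  obtain B1 where B1: "0 < B1" "\<And>\<theta> y. (\<And>k. \<bar>\<theta> k\<bar> \<le> 1) \<Longrightarrow> \<bar>bumps p (Suc w) \<theta> y\<bar> \<le> B1"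
    using bumps_bounded[of p "Suc w"] by blast
  obtain B2 where B2: "0 < B2" "\<And>\<theta> y. (\<And>k. \<bar>\<theta> k\<bar> \<le> 1) \<Longrightarrow> \<bar>bumps p 0 \<theta> y\<bar> \<le> B2"
    using bumps_bounded[of p 0] by blast
  let ?B = "2 * B0 + B1 + B2"
  show ?thesis
  proof (rule that[of ?B])
    fix M :: nat and A L Mx :: real and \<theta> :: "int \<Rightarrow> real"
    assume M: "1 \<le> M" and A: "0 \<le> A" and \<theta>: "\<And>k. \<bar>\<theta> k\<bar> \<le> 1"
      and L: "A * real M powr \<alpha> * ?B \<le> L" and Mx: "A * ?B \<le> Mx"
    define D where "D k x = A * real M ^ k * bumps p k \<theta> (real M * x)" for k x
    have deriv: "(D k has_real_derivative D (Suc k) x) (at x within X)" if "k \<le> w" for k x X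
      unfolding D_def
      using DERIV_chain2[where g = "\<lambda>x. real M * x" and x = x and s = X, OF bumps_has_derivative[of k p \<theta>], of "real M"] that p
      by (auto intro!: derivative_eq_intros simp: w_def)
    have lip: "\<bar>bumps p w \<theta> s - bumps p w \<theta> t\<bar> \<le> B1 * \<bar>s - t\<bar>" for s t
      using field_differentiable_bound[of UNIV "bumps p w \<theta>" "bumps p (Suc w) \<theta>" B1 s t]
        bumps_has_derivative[of w p \<theta>] B1(2)[OF \<theta>] p by (auto simp: w_def)
    \<comment> \<open>Up to distance 1 the Lipschitz bound implies the claim, beyond 1 boundedness
      does.\<close>
    have hoel: "\<bar>bumps p w \<theta> s - bumps p w \<theta> t\<bar> \<le> ?B * \<bar>s - t\<bar> powr \<gamma>" for s t
    proof (cases "\<bar>s - t\<bar> \<le> 1")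
      case True
      have "\<bar>bumps p w \<theta> s - bumps p w \<theta> t\<bar> \<le> ?B * \<bar>s - t\<bar>"
        using lip[of s t] B0 B2 by (smt (verit) mult_right_mono abs_ge_zero)
      also have "\<bar>s - t\<bar> \<le> \<bar>s - t\<bar> powr \<gamma>"
        using True \<gamma> powr_mono'[of \<gamma> 1 "\<bar>s - t\<bar>"] by (cases "s = t") auto
      then have "?B * \<bar>s - t\<bar> \<le> ?B * \<bar>s - t\<bar> powr \<gamma>" using B0 B1 B2 by (intro mult_left_mono) auto
      finally show ?thesis .
    next
      case False
      have "\<bar>bumps p w \<theta> s - bumps p w \<theta> t\<bar> \<le> ?B * 1"
        using B0(2)[of \<theta> s, OF \<theta>] B0(2)[of \<theta> t, OF \<theta>] B1(1) B2(1)
          abs_triangle_ineq4[of "bumps p w \<theta> s" "bumps p w \<theta> t"] by argo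
      also have "1 \<le> \<bar>s - t\<bar> powr \<gamma>" using False \<gamma> by (intro ge_one_powr_ge_zero) auto
      then have "?B * 1 \<le> ?B * \<bar>s - t\<bar> powr \<gamma>" using B0 B1 B2 by (intro mult_left_mono) auto
      finally show ?thesis .
    qed
    show "hoelder \<alpha> L Mx (\<lambda>x. A * bumps p 0 \<theta> (real M * x))"
      unfolding hoelder_def w_def[symmetric]
    proof (intro conjI exI[of _ D] ballI allI impI)
      fix x :: real
      have "A * \<bar>bumps p 0 \<theta> (real M * x)\<bar> \<le> A * ?B"
        using B2(2)[of \<theta> "real M * x", OF \<theta>] A B0 B1 by (intro mult_left_mono) auto
      then show "\<bar>A * bumps p 0 \<theta> (real M * x)\<bar> \<le> Mx" using A Mx by (simp add: abs_mult)
      show "D 0 x = A * bumps p 0 \<theta> (real M * x)" by (simp add: D_def)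
    next
      show "continuous_on {0..1} (D w)"
        using deriv[of w] by (auto intro!: DERIV_continuous_on)
    next
      fix s t :: real
      have "\<bar>D w s - D w t\<bar> = A * real M ^ w * \<bar>bumps p w \<theta> (real M * s) - bumps p w \<theta> (real M * t)\<bar>"
        using A by (simp add: D_def abs_mult flip: right_diff_distrib)
      also have "\<dots> \<le> A * real M ^ w * (?B * \<bar>real M * s - real M * t\<bar> powr \<gamma>)"
        using A by (intro mult_left_mono hoel) auto
      also have "\<bar>real M * s - real M * t\<bar> powr \<gamma> = real M powr \<gamma> * \<bar>s - t\<bar> powr \<gamma>"
        by (simp add: abs_mult powr_mult flip: right_diff_distrib)
      also have "A * real M ^ w * (?B * (real M powr \<gamma> * \<bar>s - t\<bar> powr \<gamma>))
          = (A * (real M powr w * real M powr \<gamma>) * ?B) * \<bar>s - t\<bar> powr \<gamma>"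
        using M by (simp add: powr_realpow mult_ac)
      also have "real M powr w * real M powr \<gamma> = real M powr \<alpha>"
        by (simp add: \<gamma>_def flip: powr_add)
      also have "(A * real M powr \<alpha> * ?B) * \<bar>s - t\<bar> powr \<gamma> \<le> L * \<bar>s - t\<bar> powr \<gamma>"
        using L by (intro mult_right_mono) auto
      finally show "\<bar>D w s - D w t\<bar> \<le> L * \<bar>s - t\<bar> powr (\<alpha> - real w)" by (simp add: \<gamma>_def)
    qed (use deriv in auto)
  qed (use B0 B1 B2 in auto)
qed

subsection \<open>Gaussian regression samples\<close>

lemma ennsqrt_ennreal: "0 \<le> a \<Longrightarrow> ennsqrt (ennreal a) = ennreal (sqrt a)"
  by (simp add: ennsqrt_def)

lemma indicator_PiE_restrict:
  assumes "finite I"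
  shows "indicator (Pi\<^sub>E I B) (\<lambda>j\<in>I. z j) = (\<Prod>j\<in>I. indicator (B j) (z j) :: ennreal)"
proof (cases "\<forall>j\<in>I. z j \<in> B j")
  case False
  then show ?thesis using assms by (auto simp: indicator_def PiE_iff prod_zero_iff)
qed (simp add: indicator_def PiE_iff)

text \<open>The curve is the only link between the observations of one subject. Without randomness
  in it the pairs are independent, so that \<open>near_PiM\<close> also applies to the index
  \<open>j\<close>. It suffices to compare boxes, where the integral over design and noise
  factorizes.\<close>

lemma curve_obs_deterministic:
  assumes "prob_space \<eta>" "prob_space \<nu>" and s [measurable_cong]: "sets \<eta> = sets borel" "sets \<nu> = sets borel"
    and f [measurable]: "f \<in> borel_measurable borel"
  shows "curve_obs m \<eta> (return borel 0) (\<lambda>\<omega>. f) \<nu>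
    = (\<Pi>\<^sub>M j\<in>{..<m}. distr (\<eta> \<Otimes>\<^sub>M \<nu>) (borel \<Otimes>\<^sub>M borel) (\<lambda>(t, e). (t, f t + e)))"
    (is "_ = PiM _ (\<lambda>_. ?D)")
proof -
  interpret \<eta>: prob_space \<eta> by fact
  interpret \<nu>: prob_space \<nu> by fact
  interpret p: pair_prob_space \<eta> \<nu> ..
  interpret D: prob_space ?D by (rule p.prob_space_distr) measurable
  interpret r: prob_space "return borel (0::real)" by (rule prob_space_return) simp
  interpret PD: product_sigma_finite "\<lambda>_::nat. ?D" ..
  interpret P\<eta>: product_sigma_finite "\<lambda>_::nat. \<eta>" ..
  interpret P\<nu>: product_sigma_finite "\<lambda>_::nat. \<nu>" ..
  let ?T = "\<Pi>\<^sub>M j\<in>{..<m}. \<eta>" let ?E = "\<Pi>\<^sub>M j\<in>{..<m}. \<nu>"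
  interpret T: prob_space ?T by (rule prob_space_PiM) (rule assms)
  interpret E: prob_space ?E by (rule prob_space_PiM) (rule assms)
  interpret TE: pair_prob_space ?T ?E ..
  have se: "sets (\<Pi>\<^sub>M j\<in>{..<m}. (borel \<Otimes>\<^sub>M borel) :: (real \<times> real) measure) = sets (PiM {..<m} (\<lambda>_. ?D))"
    by (intro sets_PiM_cong) auto
  define G where "G = (\<lambda>(t, e). \<lambda>j\<in>{..<m}. (t j, f (t j) + e j))"
  have G [measurable]: "G \<in> measurable (?T \<Otimes>\<^sub>M ?E) (\<Pi>\<^sub>M j\<in>{..<m}. (borel \<Otimes>\<^sub>M borel))"
    unfolding G_def by measurable
  have obs: "curve_obs m \<eta> (return borel 0) (\<lambda>\<omega>. f) \<nu>
    = distr (return borel (0::real) \<Otimes>\<^sub>M (?T \<Otimes>\<^sub>M ?E)) (\<Pi>\<^sub>M j\<in>{..<m}. (borel \<Otimes>\<^sub>M borel)) (\<lambda>z. G (snd z))"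
    unfolding curve_obs_def G_def by (rule distr_cong) auto
  show ?thesis
  proof (rule PD.PiM_eqI)
    fix A assume A: "\<And>i. i \<in> {..<m} \<Longrightarrow> A i \<in> sets ?D"
    \<comment> \<open>Padding with the empty set makes every \<open>B i\<close> measurable without
      the side condition \<open>i < m\<close>.\<close>
    define B where "B i = (if i < m then A i else {})" for i
    have [measurable]: "B i \<in> sets (borel \<Otimes>\<^sub>M borel)" for i
      using A[of i] by (auto simp: B_def)
    have "Pi\<^sub>E {..<m} A = Pi\<^sub>E {..<m} B" by (intro PiE_cong) (auto simp: B_def)
    moreover have [measurable]: "Pi\<^sub>E {..<m} B \<in> sets (\<Pi>\<^sub>M j\<in>{..<m}. (borel \<Otimes>\<^sub>M borel))"
      by (intro sets_PiM_I_finite) auto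
    moreover have "emeasure (curve_obs m \<eta> (return borel 0) (\<lambda>\<omega>. f) \<nu>) (Pi\<^sub>E {..<m} B)
        = (\<integral>\<^sup>+z. indicator (Pi\<^sub>E {..<m} B) z \<partial>curve_obs m \<eta> (return borel 0) (\<lambda>\<omega>. f) \<nu>)"
      by (rule nn_integral_indicator[symmetric]) (simp add: curve_obs_def)
    moreover have "\<dots> = (\<integral>\<^sup>+z. indicator (Pi\<^sub>E {..<m} B) (G (snd z)) \<partial>(return borel (0::real) \<Otimes>\<^sub>M (?T \<Otimes>\<^sub>M ?E)))"
      unfolding obs by (rule nn_integral_distr) measurable
    moreover have "\<dots> = (\<integral>\<^sup>+\<omega>. \<integral>\<^sup>+z. indicator (Pi\<^sub>E {..<m} B) (G (snd (\<omega>, z))) \<partial>(?T \<Otimes>\<^sub>M ?E) \<partial>return borel (0::real))"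
      by (rule TE.P.nn_integral_fst[symmetric]) measurable
    moreover have "\<dots> = (\<integral>\<^sup>+z. indicator (Pi\<^sub>E {..<m} B) (G (snd (0::real, z))) \<partial>(?T \<Otimes>\<^sub>M ?E))"
      by (simp add: nn_integral_return)
    moreover have "\<dots> = (\<integral>\<^sup>+t. \<integral>\<^sup>+e. indicator (Pi\<^sub>E {..<m} B) (G (snd (0::real, (t, e)))) \<partial>?E \<partial>?T)"
      unfolding snd_conv by (rule E.nn_integral_fst[symmetric]) measurable
    moreover have "\<dots> = (\<integral>\<^sup>+t. \<integral>\<^sup>+e. (\<Prod>j<m. indicator (B j) (t j, f (t j) + e j)) \<partial>?E \<partial>?T)"
      by (simp only: G_def snd_conv prod.case indicator_PiE_restrict[OF finite_lessThan])
    moreover have "\<dots> = (\<integral>\<^sup>+t. (\<Prod>j<m. \<integral>\<^sup>+e. indicator (B j) (t j, f (t j) + e) \<partial>\<nu>) \<partial>?T)"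
    proof (intro nn_integral_cong)
      fix t assume "t \<in> space ?T"
      show "(\<integral>\<^sup>+e. (\<Prod>j<m. indicator (B j) (t j, f (t j) + e j)) \<partial>?E)
        = (\<Prod>j<m. \<integral>\<^sup>+e. indicator (B j) (t j, f (t j) + e) \<partial>\<nu>)"
        by (rule P\<nu>.product_nn_integral_prod) simp_all
    qed
    moreover have "\<dots> = (\<Prod>j<m. \<integral>\<^sup>+t. \<integral>\<^sup>+e. indicator (B j) (t, f t + e) \<partial>\<nu> \<partial>\<eta>)"
      by (rule P\<eta>.product_nn_integral_prod[where f = "\<lambda>j t. \<integral>\<^sup>+e. indicator (B j) (t, f t + e) \<partial>\<nu>"]) auto
    moreover have "\<dots> = (\<Prod>j<m. emeasure ?D (A j))"
    proof (intro prod.cong refl)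
      fix j assume "j \<in> {..<m}"
      then have "emeasure ?D (A j) = emeasure ?D (B j)" by (simp add: B_def)
      also have "\<dots> = (\<integral>\<^sup>+z. indicator (B j) z \<partial>?D)" by (rule nn_integral_indicator[symmetric]) simp
      also have "\<dots> = (\<integral>\<^sup>+z. indicator (B j) ((\<lambda>(t, e). (t, f t + e)) z) \<partial>(\<eta> \<Otimes>\<^sub>M \<nu>))"
        by (rule nn_integral_distr) measurable
      also have "\<dots> = (\<integral>\<^sup>+t. \<integral>\<^sup>+e. indicator (B j) ((\<lambda>(t, e). (t, f t + e)) (t, e)) \<partial>\<nu> \<partial>\<eta>)"
        by (rule \<nu>.nn_integral_fst[symmetric]) measurable
      finally show "(\<integral>\<^sup>+t. \<integral>\<^sup>+e. indicator (B j) (t, f t + e) \<partial>\<nu> \<partial>\<eta>) = emeasure ?D (A j)" by simp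
    qed
    ultimately show "emeasure (curve_obs m \<eta> (return borel 0) (\<lambda>\<omega>. f) \<nu>) (Pi\<^sub>E {..<m} A) = (\<Prod>i<m. emeasure ?D (A i))"
      by metis
  qed (use se in \<open>auto simp: curve_obs_def\<close>)
qed

definition gaussian :: "real \<Rightarrow> real measure" where
  "gaussian \<tau> = density lborel (normal_density 0 \<tau>)"

lemma sets_gaussian [simp, measurable_cong]: "sets (gaussian \<tau>) = sets borel"
  by (simp add: gaussian_def)

lemma prob_space_gaussian: "0 < \<tau> \<Longrightarrow> prob_space (gaussian \<tau>)"
  unfolding gaussian_def by (rule prob_space_normal_density)

text \<open>Completing the square: the geometric mean of the two densities is their affinity times
  the normal density at the midpoint.\<close>

lemma sqrt_normal_density_mult:
  assumes "0 < \<tau>"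
  shows "sqrt (normal_density a \<tau> y) * sqrt (normal_density b \<tau> y)
    = exp (- (a - b)\<^sup>2 / (8 * \<tau>\<^sup>2)) * normal_density ((a + b) / 2) \<tau> y"
proof -
  have e: "- (y - a)\<^sup>2 / (2 * \<tau>\<^sup>2) + - (y - b)\<^sup>2 / (2 * \<tau>\<^sup>2)
     = 2 * (- (a - b)\<^sup>2 / (8 * \<tau>\<^sup>2) + - (y - (a + b) / 2)\<^sup>2 / (2 * \<tau>\<^sup>2))"
    using assms by (simp add: field_simps power2_eq_square)
  have "normal_density a \<tau> y * normal_density b \<tau> y
     = (exp (- (a - b)\<^sup>2 / (8 * \<tau>\<^sup>2)) * normal_density ((a + b) / 2) \<tau> y)\<^sup>2"
  proof -
    have "normal_density a \<tau> y * normal_density b \<tau> y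
       = (1 / sqrt (2 * pi * \<tau>\<^sup>2))\<^sup>2 * exp (- (y - a)\<^sup>2 / (2 * \<tau>\<^sup>2) + - (y - b)\<^sup>2 / (2 * \<tau>\<^sup>2))"
      unfolding exp_add by (simp add: normal_density_def power2_eq_square)
    also have "\<dots> = (exp (- (a - b)\<^sup>2 / (8 * \<tau>\<^sup>2)) * normal_density ((a + b) / 2) \<tau> y)\<^sup>2"
      unfolding e exp_double exp_add by (simp add: normal_density_def power_mult_distrib power_divide)
    finally show ?thesis .
  qed
  then have "sqrt (normal_density a \<tau> y * normal_density b \<tau> y)
     = sqrt ((exp (- (a - b)\<^sup>2 / (8 * \<tau>\<^sup>2)) * normal_density ((a + b) / 2) \<tau> y)\<^sup>2)" by simp
  then show ?thesis by (simp add: real_sqrt_mult abs_mult)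
qed

lemma measurable_normal_density [measurable (raw)]:
  assumes [measurable]: "f \<in> borel_measurable M" "g \<in> borel_measurable M"
  shows "(\<lambda>z. normal_density (f z) \<tau> (g z)) \<in> borel_measurable M"
  unfolding normal_density_def by measurable

text \<open>Given the design point, the affinity is at least
  \<open>1 - (f t - g t)\<^sup>2 / (8 * \<tau>\<^sup>2)\<close>. The average over the design is at
  least \<open>1 - d / 2\<close>, whose square is at least \<open>1 - d\<close>; hence the factor 4
  in the hypothesis.\<close>

lemma near_gaussian_regression:
  fixes f g :: "real \<Rightarrow> real"
  assumes \<tau>: "0 < \<tau>" and "prob_space \<eta>" and s [measurable_cong]: "sets \<eta> = sets borel"
    and [measurable]: "f \<in> borel_measurable borel" "g \<in> borel_measurable borel"
    and d: "0 \<le> d" "(\<integral>\<^sup>+t. ennreal ((f t - g t)\<^sup>2) \<partial>\<eta>) \<le> ennreal (4 * \<tau>\<^sup>2 * d)"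
  shows "near (distr (\<eta> \<Otimes>\<^sub>M gaussian \<tau>) (borel \<Otimes>\<^sub>M borel) (\<lambda>(t, e). (t, f t + e)))
    (distr (\<eta> \<Otimes>\<^sub>M gaussian \<tau>) (borel \<Otimes>\<^sub>M borel) (\<lambda>(t, e). (t, g t + e))) d"
proof -
  interpret \<eta>: prob_space \<eta> by fact
  interpret G: prob_space "gaussian \<tau>" by (rule prob_space_gaussian) fact
  interpret p: pair_prob_space \<eta> "gaussian \<tau>" ..
  interpret L: pair_sigma_finite \<eta> lborel ..
  \<comment> \<open>Both laws have densities with respect to
    \<open>\<eta> \<Otimes>\<^sub>M lborel\<close>, whatever \<open>\<eta>\<close> is.\<close>
  have int: "(\<integral>\<^sup>+z. u z \<partial>distr (\<eta> \<Otimes>\<^sub>M gaussian \<tau>) (borel \<Otimes>\<^sub>M borel) (\<lambda>(t, e). (t, h t + e)))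
    = (\<integral>\<^sup>+z. ennreal (normal_density (h (fst z)) \<tau> (snd z)) * u z \<partial>(\<eta> \<Otimes>\<^sub>M lborel))"
    if [measurable]: "h \<in> borel_measurable borel" "u \<in> borel_measurable (borel \<Otimes>\<^sub>M borel)"
    for h :: "real \<Rightarrow> real" and u :: "real \<times> real \<Rightarrow> ennreal"
  proof -
    have "(\<integral>\<^sup>+z. u z \<partial>distr (\<eta> \<Otimes>\<^sub>M gaussian \<tau>) (borel \<Otimes>\<^sub>M borel) (\<lambda>(t, e). (t, h t + e)))
      = (\<integral>\<^sup>+z. u ((\<lambda>(t, e). (t, h t + e)) z) \<partial>(\<eta> \<Otimes>\<^sub>M gaussian \<tau>))"
      by (rule nn_integral_distr) measurable
    also have "\<dots> = (\<integral>\<^sup>+t. \<integral>\<^sup>+e. u ((\<lambda>(t, e). (t, h t + e)) (t, e)) \<partial>gaussian \<tau> \<partial>\<eta>)"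
      by (rule G.nn_integral_fst[symmetric]) measurable
    also have "\<dots> = (\<integral>\<^sup>+t. \<integral>\<^sup>+y. ennreal (normal_density (h t) \<tau> y) * u (t, y) \<partial>lborel \<partial>\<eta>)"
    proof (intro nn_integral_cong)
      fix t assume "t \<in> space \<eta>"
      have "(\<integral>\<^sup>+e. u (t, h t + e) \<partial>gaussian \<tau>) = (\<integral>\<^sup>+e. ennreal (normal_density 0 \<tau> e) * u (t, h t + e) \<partial>lborel)"
        unfolding gaussian_def by (rule nn_integral_density) measurable
      also have "\<dots> = (\<integral>\<^sup>+y. ennreal (normal_density (h t) \<tau> y) * u (t, y) \<partial>lborel)"
        by (subst (2) nn_integral_real_affine[of _ 1 "h t"]) (auto simp: normal_density_def)
      finally show "(\<integral>\<^sup>+e. u ((\<lambda>(t, e). (t, h t + e)) (t, e)) \<partial>gaussian \<tau>)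
        = (\<integral>\<^sup>+y. ennreal (normal_density (h t) \<tau> y) * u (t, y) \<partial>lborel)" by simp
    qed
    also have "\<dots> = (\<integral>\<^sup>+z. ennreal (normal_density (h (fst z)) \<tau> (snd z)) * u z \<partial>(\<eta> \<Otimes>\<^sub>M lborel))"
      by (subst lborel.nn_integral_fst[symmetric]) auto
    finally show ?thesis .
  qed
  show ?thesis
    unfolding near_def
  proof (intro conjI ballI impI)
    let ?Df = "distr (\<eta> \<Otimes>\<^sub>M gaussian \<tau>) (borel \<Otimes>\<^sub>M borel) (\<lambda>(t, e). (t, f t + e))"
    let ?Dg = "distr (\<eta> \<Otimes>\<^sub>M gaussian \<tau>) (borel \<Otimes>\<^sub>M borel) (\<lambda>(t, e). (t, g t + e))"
    fix u v :: "real \<times> real \<Rightarrow> ennreal"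
    assume "u \<in> borel_measurable ?Df" "v \<in> borel_measurable ?Df"
      and uv: "\<forall>x\<in>space ?Df. 1 \<le> u x * v x"
    then have [measurable]: "u \<in> borel_measurable (borel \<Otimes>\<^sub>M borel)" "v \<in> borel_measurable (borel \<Otimes>\<^sub>M borel)"
      by auto
    let ?p = "\<lambda>z. ennreal (normal_density (f (fst z)) \<tau> (snd z))"
    let ?q = "\<lambda>z. ennreal (normal_density (g (fst z)) \<tau> (snd z))"
    have "(\<integral>\<^sup>+z. ennsqrt (?p z) * ennsqrt (?q z) \<partial>(\<eta> \<Otimes>\<^sub>M lborel))
      = (\<integral>\<^sup>+z. ennreal (exp (- (f (fst z) - g (fst z))\<^sup>2 / (8 * \<tau>\<^sup>2)) * normal_density ((f (fst z) + g (fst z)) / 2) \<tau> (snd z)) \<partial>(\<eta> \<Otimes>\<^sub>M lborel))"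
      by (simp only: ennsqrt_ennreal normal_density_nonneg ennreal_mult[symmetric] real_sqrt_ge_zero
          sqrt_normal_density_mult[OF \<tau>])
    also have "\<dots> = (\<integral>\<^sup>+t. \<integral>\<^sup>+y. ennreal (exp (- (f t - g t)\<^sup>2 / (8 * \<tau>\<^sup>2)) * normal_density ((f t + g t) / 2) \<tau> y) \<partial>lborel \<partial>\<eta>)"
      by (subst lborel.nn_integral_fst[symmetric]) auto
    also have "\<dots> = (\<integral>\<^sup>+t. ennreal (exp (- (f t - g t)\<^sup>2 / (8 * \<tau>\<^sup>2))) \<partial>\<eta>)"
    proof (intro nn_integral_cong)
      fix t
      have "(\<integral>\<^sup>+y. ennreal (normal_density ((f t + g t) / 2) \<tau> y) \<partial>lborel) = 1"
        using \<tau> by (subst nn_integral_eq_integral) auto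
      then show "(\<integral>\<^sup>+y. ennreal (exp (- (f t - g t)\<^sup>2 / (8 * \<tau>\<^sup>2)) * normal_density ((f t + g t) / 2) \<tau> y) \<partial>lborel)
        = ennreal (exp (- (f t - g t)\<^sup>2 / (8 * \<tau>\<^sup>2)))"
        by (simp add: ennreal_mult nn_integral_cmult)
    qed
    finally have aff: "(\<integral>\<^sup>+z. ennsqrt (?p z) * ennsqrt (?q z) \<partial>(\<eta> \<Otimes>\<^sub>M lborel))
      = (\<integral>\<^sup>+t. ennreal (exp (- (f t - g t)\<^sup>2 / (8 * \<tau>\<^sup>2))) \<partial>\<eta>)" (is "_ = ?I") .
    have "1 = (\<integral>\<^sup>+t. 1 \<partial>\<eta>)" by (simp add: \<eta>.emeasure_space_1)
    also have "\<dots> \<le> (\<integral>\<^sup>+t. ennreal (exp (- (f t - g t)\<^sup>2 / (8 * \<tau>\<^sup>2))) + ennreal (1 / (8 * \<tau>\<^sup>2)) * ennreal ((f t - g t)\<^sup>2) \<partial>\<eta>)"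
    proof (intro nn_integral_mono)
      fix t
      have "1 \<le> exp (- (f t - g t)\<^sup>2 / (8 * \<tau>\<^sup>2)) + (1 / (8 * \<tau>\<^sup>2)) * (f t - g t)\<^sup>2"
        using exp_ge_add_one_self[of "- (f t - g t)\<^sup>2 / (8 * \<tau>\<^sup>2)"] by simp
      then show "1 \<le> ennreal (exp (- (f t - g t)\<^sup>2 / (8 * \<tau>\<^sup>2))) + ennreal (1 / (8 * \<tau>\<^sup>2)) * ennreal ((f t - g t)\<^sup>2)"
        by (simp flip: ennreal_plus ennreal_mult ennreal_1 del: times_divide_eq_left)
    qed
    also have "\<dots> = ?I + ennreal (1 / (8 * \<tau>\<^sup>2)) * (\<integral>\<^sup>+t. ennreal ((f t - g t)\<^sup>2) \<partial>\<eta>)"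
      by (simp add: nn_integral_add nn_integral_cmult)
    also have "\<dots> \<le> ?I + ennreal (1 / (8 * \<tau>\<^sup>2)) * ennreal (4 * \<tau>\<^sup>2 * d)"
      using d by (intro add_left_mono mult_left_mono) auto
    also have "ennreal (1 / (8 * \<tau>\<^sup>2)) * ennreal (4 * \<tau>\<^sup>2 * d) = ennreal (d / 2)"
      using d \<tau> by (simp flip: ennreal_mult)
    finally have I: "ennreal (1 - d / 2) \<le> ?I"
      using d by (simp add: ennreal_minus[symmetric] ennreal_minus_le_iff add.commute)
    have "ennreal (1 - d) \<le> ?I\<^sup>2"
    proof (cases "d \<le> 1")
      case True
      have "ennreal (1 - d) \<le> ennreal ((1 - d / 2)\<^sup>2)"
        by (intro ennreal_leI) (simp add: power2_eq_square algebra_simps)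
      also have "\<dots> = (ennreal (1 - d / 2))\<^sup>2" using True by (subst ennreal_power) auto
      also have "\<dots> \<le> ?I\<^sup>2" using I by (intro power_mono) auto
      finally show ?thesis .
    qed (simp add: ennreal_neg)
    also have "?I\<^sup>2 \<le> (\<integral>\<^sup>+z. ?p z * u z \<partial>(\<eta> \<Otimes>\<^sub>M lborel)) * (\<integral>\<^sup>+z. ?q z * v z \<partial>(\<eta> \<Otimes>\<^sub>M lborel))"
      unfolding aff[symmetric] using uv by (intro density_Cauchy_Schwarz) (auto simp: space_pair_measure)
    finally show "ennreal (1 - d) \<le> (\<integral>\<^sup>+z. u z \<partial>?Df) * (\<integral>\<^sup>+z. v z \<partial>?Dg)"
      by (simp add: int)
    qed (use d in \<open>auto intro!: p.prob_space_distr[of "\<lambda>(t, e). (t, f t + e)"]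
      p.prob_space_distr[of "\<lambda>(t, e). (t, g t + e)"]\<close>)
qed

text \<open>On the event \<open>u \<le> c * e\<close> the centred density is at most
  \<open>exp (- u\<^sup>2 / (2 * \<tau>\<^sup>2))\<close> times the density with mean
  \<open>c * u\<close>, which integrates to 1. The sign \<open>c\<close> selects one of the two
  tails.\<close>

lemma gaussian_tail:
  assumes \<tau>: "0 < \<tau>" and u: "0 < u"
  shows "measure (gaussian \<tau>) {e. u \<le> \<bar>e\<bar>} \<le> 2 * exp (- u\<^sup>2 / (2 * \<tau>\<^sup>2))"
proof -
  interpret prob_space "gaussian \<tau>" by (rule prob_space_gaussian) fact
  have half: "emeasure (gaussian \<tau>) {e. u \<le> c * e} \<le> ennreal (exp (- u\<^sup>2 / (2 * \<tau>\<^sup>2)))"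
    if c: "c = 1 \<or> c = - 1" for c
  proof -
    have "emeasure (gaussian \<tau>) {e. u \<le> c * e} = (\<integral>\<^sup>+e. ennreal (normal_density 0 \<tau> e) * indicator {e. u \<le> c * e} e \<partial>lborel)"
      unfolding gaussian_def by (rule emeasure_density) auto
    also have "\<dots> \<le> (\<integral>\<^sup>+e. ennreal (exp (- u\<^sup>2 / (2 * \<tau>\<^sup>2))) * ennreal (normal_density (c * u) \<tau> e) \<partial>lborel)"
    proof (intro nn_integral_mono)
      fix e
      show "ennreal (normal_density 0 \<tau> e) * indicator {e. u \<le> c * e} e
        \<le> ennreal (exp (- u\<^sup>2 / (2 * \<tau>\<^sup>2))) * ennreal (normal_density (c * u) \<tau> e)"
      proof (cases "u \<le> c * e")
        case True
        have "u * u \<le> u * (c * e)" using True u by (intro mult_left_mono) auto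
        then have "- e\<^sup>2 \<le> - u\<^sup>2 + - (e - c * u)\<^sup>2"
          using c by (auto simp: power2_eq_square algebra_simps)
        then have "- e\<^sup>2 / (2 * \<tau>\<^sup>2) \<le> (- u\<^sup>2 + - (e - c * u)\<^sup>2) / (2 * \<tau>\<^sup>2)"
          by (intro divide_right_mono) auto
        then have "exp (- e\<^sup>2 / (2 * \<tau>\<^sup>2)) \<le> exp (- u\<^sup>2 / (2 * \<tau>\<^sup>2)) * exp (- (e - c * u)\<^sup>2 / (2 * \<tau>\<^sup>2))"
          by (simp add: add_divide_distrib diff_divide_distrib flip: exp_add)
        then have "normal_density 0 \<tau> e \<le> exp (- u\<^sup>2 / (2 * \<tau>\<^sup>2)) * normal_density (c * u) \<tau> e"
          using \<tau> by (simp add: normal_density_def divide_right_mono)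
        then show ?thesis using True by (simp flip: ennreal_mult)
      qed simp
    qed
    also have "\<dots> = ennreal (exp (- u\<^sup>2 / (2 * \<tau>\<^sup>2))) * (\<integral>\<^sup>+e. ennreal (normal_density (c * u) \<tau> e) \<partial>lborel)"
      by (simp add: nn_integral_cmult)
    also have "(\<integral>\<^sup>+e. ennreal (normal_density (c * u) \<tau> e) \<partial>lborel) = 1"
      using \<tau> by (subst nn_integral_eq_integral) auto
    finally show ?thesis by simp
  qed
  have "emeasure (gaussian \<tau>) {e. u \<le> \<bar>e\<bar>} \<le> emeasure (gaussian \<tau>) ({e. u \<le> 1 * e} \<union> {e. u \<le> (- 1) * e})"
    by (intro emeasure_mono) auto
  also have "\<dots> \<le> emeasure (gaussian \<tau>) {e. u \<le> 1 * e} + emeasure (gaussian \<tau>) {e. u \<le> (- 1) * e}"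
    by (intro emeasure_subadditive) auto
  also have "\<dots> \<le> ennreal (exp (- u\<^sup>2 / (2 * \<tau>\<^sup>2))) + ennreal (exp (- u\<^sup>2 / (2 * \<tau>\<^sup>2)))"
    by (intro add_mono half) auto
  also have "\<dots> = ennreal (2 * exp (- u\<^sup>2 / (2 * \<tau>\<^sup>2)))" by (simp flip: ennreal_plus)
  finally show ?thesis by (simp add: emeasure_eq_measure)
qed

lemma valid_sample_gaussian:
  assumes \<tau>: "0 < \<tau>" and [measurable]: "f \<in> borel_measurable borel"
  shows "valid_sample \<tau> (return borel 0) (\<lambda>\<omega>. f) (gaussian \<tau>)"
    and "mean_fun (return borel 0) (\<lambda>\<omega>. f) = f"
proof -
  interpret r: prob_space "return borel (0::real)" by (rule prob_space_return) simp
  show m: "mean_fun (return borel 0) (\<lambda>\<omega>. f) = f"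
    using r.prob_space by (simp add: mean_fun_def fun_eq_iff)
  have "integrable (gaussian \<tau>) (\<lambda>e. e)" "(\<integral>e. e \<partial>gaussian \<tau>) = 0"
    using integrable_normal_moment_nz_1[of \<tau> 0] integral_normal_moment_nz_1[of \<tau> 0] \<tau>
    by (simp_all add: gaussian_def integrable_density integral_density)
  moreover have "(\<lambda>(\<omega>::real, x). f x) \<in> borel_measurable (borel \<Otimes>\<^sub>M borel)" by measurable
  moreover have "measure (return borel (0::real)) {\<omega>. u \<le> \<bar>f x - f x\<bar>} \<le> 2 * exp (- u\<^sup>2 / (2 * \<tau>\<^sup>2))"
    if "0 < u" for u x
  proof -
    have "{\<omega>::real. u \<le> \<bar>f x - f x\<bar>} = {}" using that by auto
    then show ?thesis by simp
  qed
  moreover have "integrable (return borel (0::real)) (\<lambda>\<omega>. f x)" for x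
    by (rule r.integrable_const)
  ultimately show "valid_sample \<tau> (return borel 0) (\<lambda>\<omega>. f) (gaussian \<tau>)"
    unfolding valid_sample_def m
    by (intro conjI allI ballI impI gaussian_tail prob_space_gaussian r.prob_space_axioms \<tau> sets_return sets_gaussian)
qed

subsection \<open>Samples of coin curves\<close>

text \<open>The value 0 outside the \<open>M\<close> cells also covers the right end
  \<open>x = 1\<close>, where \<open>\<lfloor>real M * x\<rfloor> = M\<close>.\<close>

definition cell_sign :: "nat \<Rightarrow> nat set \<Rightarrow> int \<Rightarrow> real" where
  "cell_sign M S k = (if 0 \<le> k \<and> k < int M then if nat k \<in> S then 1 else - 1 else 0)"

definition bump_sum :: "nat \<Rightarrow> nat \<Rightarrow> real \<Rightarrow> nat set \<Rightarrow> real \<Rightarrow> real" where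
  "bump_sum p M A S x = A * bumps p 0 (cell_sign M S) (real M * x)"

lemma bump_sum_eq:
  "bump_sum p M A S x = A * cell_sign M S \<lfloor>real M * x\<rfloor> * poly (hat p 0) (frac (real M * x))"
  by (simp add: bump_sum_def bumps_def)

lemma abs_cell_sign_le: "\<bar>cell_sign M S k\<bar> \<le> 1"
  by (simp add: cell_sign_def)

lemma abs_hat_0_le: "u \<in> {0..1} \<Longrightarrow> \<bar>poly (hat p 0) u\<bar> \<le> 1"
proof -
  assume "u \<in> {0..1}"
  then have "0 \<le> u * (1 - u)" "u * (1 - u) \<le> 1"
    by (auto intro!: mult_le_one mult_nonneg_nonneg)
  then show ?thesis unfolding poly_hat_0 by (auto simp: power_le_one)
qed

lemma abs_bump_sum_le: "0 \<le> A \<Longrightarrow> \<bar>bump_sum p M A S x\<bar> \<le> A"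
proof -
  assume A: "0 \<le> A"
  have "\<bar>cell_sign M S \<lfloor>real M * x\<rfloor>\<bar> * \<bar>poly (hat p 0) (frac (real M * x))\<bar> \<le> 1 * 1"
    by (intro mult_mono abs_cell_sign_le abs_hat_0_le frac_unit) auto
  then have "A * (\<bar>cell_sign M S \<lfloor>real M * x\<rfloor>\<bar> * \<bar>poly (hat p 0) (frac (real M * x))\<bar>) \<le> A * 1"
    using A by (intro mult_left_mono) auto
  then show ?thesis using A by (simp add: bump_sum_eq abs_mult mult_ac)
qed

text \<open>The signs depend on \<open>f z\<close> only through an integer, so there are countably
  many sign patterns to glue. \<open>valid_sample\<close> asks for measurability in curve index and
  location jointly.\<close>

lemma measurable_bump_sum_joint:
  assumes [measurable]: "f \<in> borel_measurable N" "g \<in> borel_measurable N"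
  shows "(\<lambda>z. bump_sum p M A {k. bit (nat \<lfloor>f z :: real\<rfloor>) k} (g z)) \<in> borel_measurable N"
proof -
  have "(\<lambda>z. cell_sign M {k. bit (nat \<lfloor>f z\<rfloor>) k} \<lfloor>real M * g z\<rfloor>) \<in> borel_measurable N"
  proof (rule measurable_compose_countable[where g = "\<lambda>z. \<lfloor>f z\<rfloor>" and f = "\<lambda>i z. cell_sign M {k. bit (nat i) k} \<lfloor>real M * g z\<rfloor>"])
    fix i show "(\<lambda>z. cell_sign M {k. bit (nat i) k} \<lfloor>real M * g z\<rfloor>) \<in> borel_measurable N"
      by (rule measurable_compose[of "\<lambda>z. \<lfloor>real M * g z\<rfloor>" N "count_space UNIV"]) measurable
  qed measurable
  moreover have "(\<lambda>z. poly (hat p 0) (frac (real M * g z))) \<in> borel_measurable N"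
    unfolding poly_hat_0 frac_def by measurable
  ultimately show ?thesis
    unfolding bump_sum_eq by measurable
qed

lemma measurable_bump_sum [measurable]: "bump_sum p M A S \<in> borel_measurable borel"
proof -
  have "(\<lambda>x. cell_sign M S \<lfloor>real M * x\<rfloor>) \<in> borel_measurable borel"
    by (rule measurable_compose[of "\<lambda>x. \<lfloor>real M * x\<rfloor>" _ "count_space UNIV"]) measurable
  moreover have "(\<lambda>x. poly (hat p 0) (frac (real M * x))) \<in> borel_measurable borel"
    unfolding poly_hat_0 frac_def by measurable
  ultimately show ?thesis
    unfolding bump_sum_eq[abs_def] by measurable
qed

definition biased_coin :: "real \<Rightarrow> bool measure" where
  "biased_coin s = measure_pmf (bernoulli_pmf ((1 + s) / 2))"

lemma prob_space_biased_coin: "prob_space (biased_coin s)"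
  by (simp add: biased_coin_def measure_pmf.prob_space_axioms)

lemma sets_biased_coin [simp, measurable_cong]: "sets (biased_coin s) = sets (count_space UNIV)"
  by (simp add: biased_coin_def)

text \<open>The affinity of the two coins is \<open>sqrt (1 - s\<^sup>2)\<close>.\<close>

lemma near_biased_coin:
  assumes "\<bar>s\<bar> \<le> 1"
  shows "near (biased_coin s) (biased_coin (- s)) (s\<^sup>2)"
  unfolding near_def
proof (intro conjI ballI impI)
  fix u v :: "bool \<Rightarrow> ennreal"
  assume uv: "\<forall>x\<in>space (biased_coin s). 1 \<le> u x * v x"
  let ?p = "\<lambda>b. ennreal (pmf (bernoulli_pmf ((1 + s) / 2)) b)"
  let ?q = "\<lambda>b. ennreal (pmf (bernoulli_pmf ((1 + - s) / 2)) b)"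
  have "(\<integral>\<^sup>+b. ennsqrt (?p b) * ennsqrt (?q b) \<partial>count_space UNIV)
    = ennreal (sqrt ((1 + s) / 2) * sqrt ((1 - s) / 2)) + ennreal (sqrt ((1 - s) / 2) * sqrt ((1 + s) / 2))"
    using assms by (subst nn_integral_count_space_finite)
      (simp_all add: UNIV_bool ennsqrt_ennreal ennreal_mult field_simps abs_le_iff)
  also have "\<dots> = ennreal (2 * sqrt ((1 + s) / 2 * ((1 - s) / 2)))"
    using assms unfolding real_sqrt_mult
    by (subst ennreal_plus[symmetric]) (auto simp: mult.commute abs_le_iff)
  also have "(1 + s) / 2 * ((1 - s) / 2) = (1 - s\<^sup>2) / 4"
    by (simp add: power2_eq_square algebra_simps)
  finally have "(\<integral>\<^sup>+b. ennsqrt (?p b) * ennsqrt (?q b) \<partial>count_space UNIV)\<^sup>2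
    = ennreal ((2 * sqrt ((1 - s\<^sup>2) / 4))\<^sup>2)"
    using assms by (simp add: ennreal_power abs_square_le_1)
  also have "(2 * sqrt ((1 - s\<^sup>2) / 4))\<^sup>2 = 1 - s\<^sup>2"
    using assms by (simp add: power_mult_distrib abs_square_le_1)
  finally have "ennreal (1 - s\<^sup>2) = (\<integral>\<^sup>+b. ennsqrt (?p b) * ennsqrt (?q b) \<partial>count_space UNIV)\<^sup>2" ..
  also have "\<dots> \<le> (\<integral>\<^sup>+b. ?p b * u b \<partial>count_space UNIV) * (\<integral>\<^sup>+b. ?q b * v b \<partial>count_space UNIV)"
    using uv by (intro density_Cauchy_Schwarz) (auto simp: biased_coin_def)
  finally show "ennreal (1 - s\<^sup>2) \<le> (\<integral>\<^sup>+b. u b \<partial>biased_coin s) * (\<integral>\<^sup>+b. v b \<partial>biased_coin (- s))"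
    unfolding biased_coin_def nn_integral_measure_pmf .
qed (simp_all add: prob_space_biased_coin)

lemma integral_biased_coin_sign:
  assumes "\<bar>s\<bar> \<le> 1"
  shows "(\<integral>b. (if b then 1 else - 1) \<partial>biased_coin s) = s"
  using assms unfolding biased_coin_def
  by (subst integral_measure_pmf[where A = UNIV]) (auto simp: UNIV_bool field_simps abs_le_iff)

definition coins :: "nat \<Rightarrow> real \<Rightarrow> nat set \<Rightarrow> (nat \<Rightarrow> bool) measure" where
  "coins M s S = (\<Pi>\<^sub>M k\<in>{..<M}. biased_coin (if k \<in> S then s else - s))"

text \<open>Curves are indexed by a real number, so the independent coins of the cells are stored in its
  binary digits.\<close>

definition encode :: "nat \<Rightarrow> (nat \<Rightarrow> bool) \<Rightarrow> real" where
  "encode M b = real (\<Sum>k<M. of_bool (b k) * 2 ^ k)"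

lemma bit_encode: "k < M \<Longrightarrow> bit (nat \<lfloor>encode M b\<rfloor>) k = b k"
proof -
  have "(\<Sum>k<M. of_bool (b k) * 2 ^ k) = (horner_sum of_bool 2 (map b [0..<M]) :: nat)"
    by (simp add: horner_sum_eq_sum lessThan_atLeast0)
  then show "k < M \<Longrightarrow> bit (nat \<lfloor>encode M b\<rfloor>) k = b k"
    unfolding encode_def floor_of_nat nat_int by (simp add: bit_horner_sum_bit_iff)
qed

lemma measurable_coin [measurable]: "k < M \<Longrightarrow> (\<lambda>b. b k) \<in> measurable (coins M s S) (count_space UNIV)"
proof -
  assume "k < M"
  then have "(\<lambda>b. b k) \<in> measurable (coins M s S) (biased_coin (if k \<in> S then s else - s))"
    unfolding coins_def by (intro measurable_component_singleton) auto
  then show ?thesis by (subst (asm) measurable_cong_sets[OF refl sets_biased_coin])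
qed

lemma measurable_encode [measurable]: "encode M \<in> borel_measurable (coins M s S)"
proof -
  have "(\<lambda>b. \<Sum>k<M. of_bool (b k) * 2 ^ k :: real) \<in> borel_measurable (coins M s S)"
  proof (rule borel_measurable_sum)
    fix k assume "k \<in> {..<M}"
    then have [measurable]: "(\<lambda>b. b k) \<in> measurable (coins M s S) (count_space UNIV)" by simp
    show "(\<lambda>b. of_bool (b k) * 2 ^ k :: real) \<in> borel_measurable (coins M s S)"
      unfolding of_bool_def by measurable
  qed
  then show ?thesis by (simp add: encode_def[abs_def])
qed

lemma prob_space_coins: "prob_space (coins M s S)"
  unfolding coins_def by (rule prob_space_PiM) (rule prob_space_biased_coin)

lemma near_coins:
  assumes "\<bar>s\<bar> \<le> 1" "k < M" "k \<notin> S"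
  shows "near (coins M s S) (coins M s (insert k S)) (s\<^sup>2)"
proof -
  have "near (coins M s S) (coins M s (insert k S)) (\<Sum>i<M. if i = k then s\<^sup>2 else 0)"
    unfolding coins_def
    using assms near_biased_coin[of "- s"] by (intro near_PiM) (auto simp: near_refl prob_space_biased_coin)
  then show ?thesis using assms by simp
qed

text \<open>Every realization has the full amplitude \<open>a\<close>, however small the mean is;
  the signal sits in the bias of the coins. A mean of amplitude \<open>a * s\<close> therefore costs
  only \<open>s\<^sup>2\<close> per curve and cell.\<close>

definition coin_curve :: "nat \<Rightarrow> nat \<Rightarrow> real \<Rightarrow> real \<Rightarrow> real \<Rightarrow> real" where
  "coin_curve p M a \<omega> x = bump_sum p M a {k. bit (nat \<lfloor>\<omega>\<rfloor>) k} x"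

text \<open>At a fixed \<open>x\<close> only the coin of the cell containing \<open>x\<close>
  matters, and its mean sign is \<open>s\<close> or \<open>- s\<close>.\<close>

lemma mean_fun_coin_curve:
  assumes s: "\<bar>s\<bar> \<le> 1"
  shows "mean_fun (distr (coins M s S) borel (encode M)) (coin_curve p M a) = bump_sum p M (a * s) S"
proof
  fix x
  let ?k = "\<lfloor>real M * x\<rfloor>" let ?w = "poly (hat p 0) (frac (real M * x))"
  have [measurable]: "(\<lambda>\<omega>. coin_curve p M a \<omega> x) \<in> borel_measurable borel"
    unfolding coin_curve_def by (rule measurable_bump_sum_joint) measurable
  have sg: "(\<lambda>c. if c then 1 else - 1 :: real) \<in> borel_measurable (biased_coin r)" for r
    by (subst measurable_cong_sets[OF sets_biased_coin refl]) simp
  have "mean_fun (distr (coins M s S) borel (encode M)) (coin_curve p M a) x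
    = (\<integral>b. coin_curve p M a (encode M b) x \<partial>coins M s S)"
    unfolding mean_fun_def by (rule integral_distr) measurable
  also have "\<dots> = bump_sum p M (a * s) S x"
  proof (cases "0 \<le> ?k \<and> ?k < int M")
    case True
    then have k: "nat ?k < M" by linarith
    have "(\<integral>b. coin_curve p M a (encode M b) x \<partial>coins M s S)
      = (\<integral>b. a * ?w * (if b (nat ?k) then 1 else - 1) \<partial>coins M s S)"
      using True bit_encode[OF k]
      by (intro Bochner_Integration.integral_cong) (auto simp: coin_curve_def bump_sum_eq cell_sign_def)
    also have "\<dots> = a * ?w * (\<integral>b. (if b (nat ?k) then 1 else - 1) \<partial>coins M s S)"
      by simp
    also have "(\<integral>b. (if b (nat ?k) then 1 else - 1) \<partial>coins M s S)
      = (\<integral>c. (if c then 1 else - 1 :: real) \<partial>distr (coins M s S) (biased_coin (if nat ?k \<in> S then s else - s)) (\<lambda>b. b (nat ?k)))"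
      using k sg by (intro integral_distr[symmetric]) auto
    also have "distr (coins M s S) (biased_coin (if nat ?k \<in> S then s else - s)) (\<lambda>b. b (nat ?k)) = biased_coin (if nat ?k \<in> S then s else - s)"
      unfolding coins_def using k by (intro distr_PiM_component) (auto intro: prob_space_biased_coin)
    also have "(\<integral>c. (if c then 1 else - 1 :: real) \<partial>biased_coin (if nat ?k \<in> S then s else - s)) = (if nat ?k \<in> S then s else - s)"
      using s by (intro integral_biased_coin_sign) auto
    finally show ?thesis using True by (simp add: bump_sum_eq cell_sign_def)
  next
    case False
    then have "cell_sign M S' ?k = 0" for S' unfolding cell_sign_def by (rule if_not_P)
    then show ?thesis by (simp add: coin_curve_def bump_sum_eq)
  qed
  finally show "mean_fun (distr (coins M s S) borel (encode M)) (coin_curve p M a) x = bump_sum p M (a * s) S x" .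
qed

lemma valid_sample_coin_curve:
  assumes \<tau>: "0 < \<tau>" and a: "0 \<le> a" "4 * a \<le> \<tau>" and s: "0 \<le> s" "s \<le> 1"
  shows "valid_sample \<tau> (distr (coins M s S) borel (encode M)) (coin_curve p M a) (return borel 0)"
proof -
  interpret C: prob_space "coins M s S" by (rule prob_space_coins)
  interpret D: prob_space "distr (coins M s S) borel (encode M)"
    by (rule C.prob_space_distr) measurable
  interpret r: prob_space "return borel (0::real)" by (rule prob_space_return) simp
  have [measurable]: "(\<lambda>\<omega>. coin_curve p M a \<omega> x) \<in> borel_measurable borel" for x
    unfolding coin_curve_def by (rule measurable_bump_sum_joint) measurable
  have meas: "(\<lambda>(\<omega>, x). coin_curve p M a \<omega> x) \<in> borel_measurable (borel \<Otimes>\<^sub>M borel)"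
    unfolding coin_curve_def case_prod_beta by (rule measurable_bump_sum_joint) measurable
  have s': "\<bar>s\<bar> \<le> 1" using s by auto
  have integ: "integrable (distr (coins M s S) borel (encode M)) (\<lambda>\<omega>. coin_curve p M a \<omega> x)" for x
    by (rule D.integrable_const_bound[where B = a])
      (auto simp: coin_curve_def intro!: AE_I2 abs_bump_sum_le a measurable_bump_sum_joint)
  have as: "0 \<le> a * s" "a * s \<le> a" using a s by (auto simp: mult_left_le)
  \<comment> \<open>A deviation never exceeds \<open>2 * a\<close>, which is at most
    \<open>\<tau> / 2\<close>. For larger \<open>u\<close> the event is empty; for the remaining
    \<open>u\<close> the right-hand side is at least \<open>2 * (1 - 1 / 8)\<close> and exceeds 1.
    This is the origin of \<open>4 * a \<le> \<tau>\<close>.\<close>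
  have tail: "measure (distr (coins M s S) borel (encode M)) {\<omega>. u \<le> \<bar>coin_curve p M a \<omega> x - bump_sum p M (a * s) S x\<bar>}
      \<le> 2 * exp (- u\<^sup>2 / (2 * \<tau>\<^sup>2))" (is "measure ?D ?A \<le> _") if u: "0 < u" for u x
  proof (cases "2 * a < u")
    case True
    have "\<bar>coin_curve p M a \<omega> x - bump_sum p M (a * s) S x\<bar> \<le> 2 * a" for \<omega>
      using abs_bump_sum_le[OF a(1), of p M "{k. bit (nat \<lfloor>\<omega>\<rfloor>) k}" x] abs_bump_sum_le[OF as(1), of p M S x] as
      unfolding coin_curve_def by linarith
    then have "?A = {}" using True by (auto simp: not_le intro: le_less_trans)
    then have "measure ?D ?A = 0" by (simp only: measure_empty)
    then show ?thesis by simp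
  next
    case False
    then have "u \<le> \<tau> / 2" using a by auto
    then have "u\<^sup>2 \<le> (\<tau> / 2)\<^sup>2" using u by (intro power_mono) auto
    then have "u\<^sup>2 / (2 * \<tau>\<^sup>2) \<le> 1 / 8"
      using \<tau> by (simp add: divide_simps power2_eq_square)
    then have "1 \<le> 2 * (1 + - u\<^sup>2 / (2 * \<tau>\<^sup>2))" by simp
    also have "\<dots> \<le> 2 * exp (- u\<^sup>2 / (2 * \<tau>\<^sup>2))"
      by (intro mult_left_mono exp_ge_add_one_self) auto
    finally show ?thesis using D.prob_le_1[of ?A] by linarith
  qed
  have noise: "measure (return borel (0::real)) {e. u \<le> \<bar>e\<bar>} \<le> 2 * exp (- u\<^sup>2 / (2 * \<tau>\<^sup>2))" if "0 < u" for u
    using that by (simp add: measure_return)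
  have "integrable (return borel (0::real)) (\<lambda>e. e)" "(\<integral>e. e \<partial>return borel (0::real)) = 0"
    by (simp_all add: integral_return integrable_iff_bounded nn_integral_return)
  then show ?thesis
    unfolding valid_sample_def mean_fun_coin_curve[OF s']
    using tail noise
    by (intro conjI allI ballI impI D.prob_space_axioms r.prob_space_axioms meas integ sets_return sets_distr)
qed

section \<open>Cost of one sign flip for a whole sample, in both modes\<close>

lemma prob_space_curve_obs:
  assumes "prob_space \<eta>" "sets \<eta> = sets borel" "valid_sample \<tau> \<mu> X \<nu>"
  shows "prob_space (curve_obs m \<eta> \<mu> X \<nu>)"
    and "(\<lambda>(\<omega>, t, e). \<lambda>j\<in>{..<m}. (t j, X \<omega> (t j) + e j)) \<in> measurable (\<mu> \<Otimes>\<^sub>M ((\<Pi>\<^sub>M j\<in>{..<m}. \<eta>) \<Otimes>\<^sub>M (\<Pi>\<^sub>M j\<in>{..<m}. \<nu>)))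
           (\<Pi>\<^sub>M j\<in>{..<m}. (borel \<Otimes>\<^sub>M borel))"
proof -
  from assms(3) have v: "prob_space \<mu>" "sets \<mu> = sets borel" "(\<lambda>(\<omega>, x). X \<omega> x) \<in> borel_measurable (borel \<Otimes>\<^sub>M borel)"
    "prob_space \<nu>" "sets \<nu> = sets borel"
    by (auto simp: valid_sample_def)
  note [measurable_cong] = v(2,5) assms(2)
  note v(3)[measurable]
  show meas: "(\<lambda>(\<omega>, t, e). \<lambda>j\<in>{..<m}. (t j, X \<omega> (t j) + e j)) \<in> measurable (\<mu> \<Otimes>\<^sub>M ((\<Pi>\<^sub>M j\<in>{..<m}. \<eta>) \<Otimes>\<^sub>M (\<Pi>\<^sub>M j\<in>{..<m}. \<nu>)))
           (\<Pi>\<^sub>M j\<in>{..<m}. (borel \<Otimes>\<^sub>M borel))"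
    by measurable
  interpret \<mu>: prob_space \<mu> by fact
  interpret T: prob_space "\<Pi>\<^sub>M j\<in>{..<m}. \<eta>" by (rule prob_space_PiM) (rule assms)
  interpret E: prob_space "\<Pi>\<^sub>M j\<in>{..<m}. \<nu>" by (rule prob_space_PiM) (rule v)
  interpret TE: pair_prob_space "\<Pi>\<^sub>M j\<in>{..<m}. \<eta>" "\<Pi>\<^sub>M j\<in>{..<m}. \<nu>" ..
  interpret A: pair_prob_space \<mu> "(\<Pi>\<^sub>M j\<in>{..<m}. \<eta>) \<Otimes>\<^sub>M (\<Pi>\<^sub>M j\<in>{..<m}. \<nu>)" ..
  show "prob_space (curve_obs m \<eta> \<mu> X \<nu>)"
    unfolding curve_obs_def by (rule A.P.prob_space_distr[OF meas])
qed

text \<open>Data processing: the observations of a curve are a function of coins, design and noise,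
  and only one coin changes its law. Hence \<open>m\<close> and \<open>\<eta>\<close> do not enter
  the cost.\<close>

lemma near_sample_law_coin:
  assumes \<eta>: "prob_space \<eta>" "sets \<eta> = sets borel"
    and \<tau>: "0 < \<tau>" and a: "0 \<le> a" "4 * a \<le> \<tau>" and s: "0 \<le> s" "s \<le> 1"
    and k: "k < M" "k \<notin> S"
  shows "near (sample_law n m \<eta> (distr (coins M s S) borel (encode M)) (coin_curve p M a) (return borel 0))
    (sample_law n m \<eta> (distr (coins M s (insert k S)) borel (encode M)) (coin_curve p M a) (return borel 0))
    (real n * s\<^sup>2)"
proof -
  have s': "\<bar>s\<bar> \<le> 1" using s by auto
  interpret r: prob_space "return borel (0::real)" by (rule prob_space_return) simp
  let ?R = "(\<Pi>\<^sub>M j\<in>{..<m}. \<eta>) \<Otimes>\<^sub>M (\<Pi>\<^sub>M j\<in>{..<m}. return borel (0::real))"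
  interpret T: prob_space "\<Pi>\<^sub>M j\<in>{..<m}. \<eta>" by (rule prob_space_PiM) (rule assms)
  interpret E: prob_space "\<Pi>\<^sub>M j\<in>{..<m}. return borel (0::real)" by (rule prob_space_PiM) (rule r.prob_space_axioms)
  interpret TE: pair_prob_space "\<Pi>\<^sub>M j\<in>{..<m}. \<eta>" "\<Pi>\<^sub>M j\<in>{..<m}. return borel (0::real)" ..
  have "near (distr (coins M s S) borel (encode M)) (distr (coins M s (insert k S)) borel (encode M)) (s\<^sup>2)"
    by (rule near_distr[OF near_coins[OF s' k]]) measurable
  from near_pair[OF this near_refl[OF TE.P.prob_space_axioms]]
  have "near (distr (coins M s S) borel (encode M) \<Otimes>\<^sub>M ?R) (distr (coins M s (insert k S)) borel (encode M) \<Otimes>\<^sub>M ?R) (s\<^sup>2)"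
    by simp
  from near_distr[OF this prob_space_curve_obs(2)[OF \<eta> valid_sample_coin_curve[OF \<tau> a s]]]
  have "near (curve_obs m \<eta> (distr (coins M s S) borel (encode M)) (coin_curve p M a) (return borel 0))
    (curve_obs m \<eta> (distr (coins M s (insert k S)) borel (encode M)) (coin_curve p M a) (return borel 0)) (s\<^sup>2)"
    unfolding curve_obs_def .
  then have "near (sample_law n m \<eta> (distr (coins M s S) borel (encode M)) (coin_curve p M a) (return borel 0))
    (sample_law n m \<eta> (distr (coins M s (insert k S)) borel (encode M)) (coin_curve p M a) (return borel 0))
    (\<Sum>i<n. s\<^sup>2)"
    unfolding sample_law_def by (intro near_PiM) auto
  then show ?thesis by simp
qed

lemma sets_cell: "{x :: real. \<lfloor>real M * x\<rfloor> = int k} \<in> sets borel"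
proof -
  have "{x :: real. \<lfloor>real M * x\<rfloor> = int k} = (\<lambda>x. \<lfloor>real M * x\<rfloor>) -` {int k} \<inter> space borel" by auto
  also have "\<dots> \<in> sets borel" by (rule measurable_sets[where A = "count_space UNIV"]) auto
  finally show ?thesis .
qed

text \<open>The two means agree outside cell \<open>k\<close> and differ there by at most
  \<open>2 * A\<close>, so each observation costs \<open>A\<^sup>2 / \<tau>\<^sup>2\<close> times
  the design mass of the cell.\<close>

lemma near_sample_law_gaussian:
  assumes \<eta>: "prob_space \<eta>" "sets \<eta> = sets borel" and \<tau>: "0 < \<tau>" and A: "0 \<le> A" and k: "k < M" "k \<notin> S"
  shows "near (sample_law n m \<eta> (return borel 0) (\<lambda>\<omega>. bump_sum p M A S) (gaussian \<tau>))
    (sample_law n m \<eta> (return borel 0) (\<lambda>\<omega>. bump_sum p M A (insert k S)) (gaussian \<tau>))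
    (real n * real m * A\<^sup>2 / \<tau>\<^sup>2 * measure \<eta> {x. \<lfloor>real M * x\<rfloor> = int k})"
proof -
  interpret \<eta>: prob_space \<eta> by fact
  note \<eta>(2)[measurable_cong]
  let ?c = "{x. \<lfloor>real M * x\<rfloor> = int k}" let ?d = "A\<^sup>2 / \<tau>\<^sup>2 * measure \<eta> ?c"
  have c: "?c \<in> sets \<eta>" using sets_cell \<eta> by simp
  have "(\<integral>\<^sup>+t. ennreal ((bump_sum p M A S t - bump_sum p M A (insert k S) t)\<^sup>2) \<partial>\<eta>)
    \<le> (\<integral>\<^sup>+t. ennreal (4 * A\<^sup>2) * indicator ?c t \<partial>\<eta>)"
  proof (intro nn_integral_mono)
    fix t
    show "ennreal ((bump_sum p M A S t - bump_sum p M A (insert k S) t)\<^sup>2) \<le> ennreal (4 * A\<^sup>2) * indicator ?c t"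
    proof (cases "t \<in> ?c")
      case True
      have "\<bar>bump_sum p M A S t - bump_sum p M A (insert k S) t\<bar> \<le> 2 * A"
        using abs_bump_sum_le[OF A, of p M S t] abs_bump_sum_le[OF A, of p M "insert k S" t] by linarith
      then have "(bump_sum p M A S t - bump_sum p M A (insert k S) t)\<^sup>2 \<le> (2 * A)\<^sup>2"
        by (metis abs_ge_zero power2_abs power_mono)
      then show ?thesis using True by (simp add: power_mult_distrib ennreal_leI)
    next
      case False
      then have "cell_sign M S \<lfloor>real M * t\<rfloor> = cell_sign M (insert k S) \<lfloor>real M * t\<rfloor>"
        by (auto simp: cell_sign_def)
      then have "bump_sum p M A S t = bump_sum p M A (insert k S) t" by (simp add: bump_sum_eq)
      then show ?thesis by simp
    qed
  qed
  also have "\<dots> = ennreal (4 * A\<^sup>2) * emeasure \<eta> ?c" by (rule nn_integral_cmult_indicator) (rule c)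
  also have "\<dots> = ennreal (4 * \<tau>\<^sup>2 * ?d)"
    using \<tau> by (simp add: \<eta>.emeasure_eq_measure flip: ennreal_mult)
  finally have int: "(\<integral>\<^sup>+t. ennreal ((bump_sum p M A S t - bump_sum p M A (insert k S) t)\<^sup>2) \<partial>\<eta>) \<le> ennreal (4 * \<tau>\<^sup>2 * ?d)" .
  have "near (sample_law n m \<eta> (return borel 0) (\<lambda>\<omega>. bump_sum p M A S) (gaussian \<tau>))
    (sample_law n m \<eta> (return borel 0) (\<lambda>\<omega>. bump_sum p M A (insert k S)) (gaussian \<tau>))
    (\<Sum>i<n. \<Sum>j<m. ?d)"
    unfolding sample_law_def
    by (simp only: curve_obs_deterministic[OF \<eta>(1) prob_space_gaussian[OF \<tau>] \<eta>(2) sets_gaussian measurable_bump_sum])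
      (intro near_PiM near_gaussian_regression[OF \<tau> \<eta>] measurable_bump_sum int finite_lessThan, simp)
  then show ?thesis by (simp add: mult.assoc)
qed

subsection \<open>Assouad's lemma\<close>

lemma sum_Pow_insert:
  fixes h :: "'a set \<Rightarrow> 'b::comm_monoid_add"
  assumes "finite I" "k \<in> I"
  shows "(\<Sum>S\<in>Pow I. h S) = (\<Sum>S\<in>Pow (I - {k}). h S + h (insert k S))"
proof -
  let ?J = "I - {k}"
  have I: "Pow I = Pow ?J \<union> insert k ` Pow ?J"
    using Pow_insert[of k ?J] assms by (simp add: insert_absorb)
  have "inj_on (insert k) (Pow ?J)"
    by (rule inj_onI) (metis Diff_iff Diff_insert_absorb PowD insertI1 subset_iff)
  then show ?thesis
    using assms unfolding I
    by (subst sum.union_disjoint) (auto simp: sum.reindex sum.distrib)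
qed

text \<open>Only an inequality, because \<open>ennreal\<close> cuts off each negative summand at 0.
  In \<open>cube_risk\<close> a cell with \<open>d k > 1\<close> can produce such a summand.\<close>

lemma ennreal_sum_le: "finite I \<Longrightarrow> ennreal (\<Sum>i\<in>I. a i) \<le> (\<Sum>i\<in>I. ennreal (a i))"
proof -
  assume "finite I"
  have "ennreal (\<Sum>i\<in>I. a i) \<le> ennreal (\<Sum>i\<in>I. max 0 (a i))"
    by (intro ennreal_leI sum_mono) auto
  also have "\<dots> = (\<Sum>i\<in>I. ennreal (max 0 (a i)))" by (intro sum_ennreal[symmetric]) auto
  also have "\<dots> = (\<Sum>i\<in>I. ennreal (a i))" by (intro sum.cong) (auto simp: max_def ennreal_neg)
  finally show ?thesis .
qed

text \<open>The set \<open>S\<close> is a vertex of the hypercube: the cells whose bump has positive sign.\<close>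

definition cube_sample :: "real \<Rightarrow> nat \<Rightarrow> nat \<Rightarrow> real \<Rightarrow> nat \<Rightarrow> nat \<Rightarrow> real measure
    \<Rightarrow> (nat set \<Rightarrow> real measure) \<Rightarrow> (nat set \<Rightarrow> real \<Rightarrow> real \<Rightarrow> real) \<Rightarrow> real measure \<Rightarrow> (nat \<Rightarrow> real) \<Rightarrow> bool" where
  "cube_sample \<tau> p M A n m \<eta> \<mu> X \<nu> d \<longleftrightarrow>
     (\<forall>S. valid_sample \<tau> (\<mu> S) (X S) \<nu> \<and> mean_fun (\<mu> S) (X S) = bump_sum p M A S) \<and>
     (\<forall>S. \<forall>k<M. k \<notin> S \<longrightarrow>
        near (sample_law n m \<eta> (\<mu> S) (X S) \<nu>) (sample_law n m \<eta> (\<mu> (insert k S)) (X (insert k S)) \<nu>) (d k))"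

section \<open>Sample laws and the risk as an integral over the unit interval\<close>

lemma prob_space_sample_law:
  assumes "prob_space \<eta>" "sets \<eta> = sets borel" "valid_sample \<tau> \<mu> X \<nu>"
  shows "prob_space (sample_law n m \<eta> \<mu> X \<nu>)"
    and "sets (sample_law n m \<eta> \<mu> X \<nu>) = sets (\<Pi>\<^sub>M i\<in>{..<n}. \<Pi>\<^sub>M j\<in>{..<m}. (borel \<Otimes>\<^sub>M borel))"
  unfolding sample_law_def
   apply (rule prob_space_PiM, rule prob_space_curve_obs(1)[OF assms])
  by (intro sets_PiM_cong refl) (simp add: curve_obs_def)

text \<open>Fubini moves the integral over \<open>x\<close> outside, since vertices are compared at
  a fixed \<open>x\<close>.\<close>

lemma risk_eq:
  fixes Q :: "data measure"
  assumes "prob_space Q" and s [measurable_cong]: "sets Q = sets N"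
    and [measurable]: "(\<lambda>(D, x). g D x) \<in> borel_measurable (N \<Otimes>\<^sub>M borel)" "f \<in> borel_measurable borel"
  shows "risk Q g f = (\<integral>\<^sup>+x. (\<integral>\<^sup>+D. ennreal ((g D x - f x)\<^sup>2) \<partial>Q) * indicator {0..1} x \<partial>lborel)"
    and "(\<lambda>x. \<integral>\<^sup>+D. ennreal ((g D x - f x)\<^sup>2) \<partial>Q) \<in> borel_measurable borel"
    and "(\<lambda>D. ennreal ((g D x - f x)\<^sup>2)) \<in> borel_measurable Q"
proof -
  interpret Q: prob_space Q by fact
  interpret L: pair_sigma_finite Q "lborel :: real measure" ..
  have g1 [measurable]: "(\<lambda>z. g (fst z) (snd z)) \<in> borel_measurable (Q \<Otimes>\<^sub>M borel)"
    using assms(3) by (simp add: case_prod_beta)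
  have g2: "(\<lambda>z. g (snd z) (fst z)) \<in> borel_measurable (borel \<Otimes>\<^sub>M Q)"
    using measurable_compose[OF measurable_pair_swap' g1] by (simp add: case_prod_beta)
  note g2 [measurable]
  show gm: "(\<lambda>D. ennreal ((g D x - f x)\<^sup>2)) \<in> borel_measurable Q" for x
  proof -
    have "(\<lambda>D. g (fst (D, x)) (snd (D, x))) \<in> borel_measurable Q"
      by (rule measurable_compose[OF _ g1]) simp
    then have [measurable]: "(\<lambda>D. g D x) \<in> borel_measurable Q" by simp
    show ?thesis by measurable
  qed
  have "(\<lambda>z. ennreal ((g (snd z) (fst z) - f (fst z))\<^sup>2)) \<in> borel_measurable (borel \<Otimes>\<^sub>M Q)"
    by measurable
  from Q.borel_measurable_nn_integral_fst[OF this]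
  show "(\<lambda>x. \<integral>\<^sup>+D. ennreal ((g D x - f x)\<^sup>2) \<partial>Q) \<in> borel_measurable borel" by simp
  have m: "(\<lambda>z. ennreal ((g (fst z) (snd z) - f (snd z))\<^sup>2) * indicator {0..1} (snd z)) \<in> borel_measurable (Q \<Otimes>\<^sub>M lborel)"
    by measurable
  have "risk Q g f = (\<integral>\<^sup>+x. (\<integral>\<^sup>+D. ennreal ((g D x - f x)\<^sup>2) * indicator {0..1} x \<partial>Q) \<partial>lborel)"
    unfolding risk_def using L.Fubini[OF m] by simp
  then show "risk Q g f = (\<integral>\<^sup>+x. (\<integral>\<^sup>+D. ennreal ((g D x - f x)\<^sup>2) \<partial>Q) * indicator {0..1} x \<partial>lborel)"
    using gm by (simp add: nn_integral_multc)
qed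

text \<open>The estimate cannot be closer than \<open>\<bar>a - b\<bar> / 2\<close> to both values.
  After division by \<open>(a - b)\<^sup>2\<close> one of the squared losses thus reaches 1/4, the
  threshold of \<open>near_two_point\<close>.\<close>

lemma two_point_risk:
  assumes near: "near P Q d" and m: "(\<lambda>x. ennreal ((h x - a)\<^sup>2)) \<in> borel_measurable P" "(\<lambda>x. ennreal ((h x - b)\<^sup>2)) \<in> borel_measurable P"
  shows "ennreal ((a - b)\<^sup>2 * (1 - d) / 16) \<le> (\<integral>\<^sup>+x. ennreal ((h x - a)\<^sup>2) \<partial>P) + (\<integral>\<^sup>+x. ennreal ((h x - b)\<^sup>2) \<partial>Q)"
proof (cases "a = b")
  case False
  have [measurable_cong]: "sets Q = sets P" using near by (auto simp: near_def)
  note m [measurable]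
  let ?D = "ennreal ((a - b)\<^sup>2)"
  let ?i = "ennreal (1 / (a - b)\<^sup>2)"
  have D: "?D * ?i = 1" using False by (simp flip: ennreal_mult)
  have "ennreal ((1 - d) / 16) \<le> (\<integral>\<^sup>+x. ?i * ennreal ((h x - a)\<^sup>2) \<partial>P) + (\<integral>\<^sup>+x. ?i * ennreal ((h x - b)\<^sup>2) \<partial>Q)"
  proof (rule near_two_point[OF near])
    fix x
    have "\<bar>a - b\<bar> / 2 \<le> \<bar>h x - a\<bar> \<or> \<bar>a - b\<bar> / 2 \<le> \<bar>h x - b\<bar>"
      using abs_triangle_ineq4[of "h x - b" "h x - a"] by (simp, argo)
    then have "(\<bar>a - b\<bar> / 2)\<^sup>2 \<le> \<bar>h x - a\<bar>\<^sup>2 \<or> (\<bar>a - b\<bar> / 2)\<^sup>2 \<le> \<bar>h x - b\<bar>\<^sup>2"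
      by (rule disj_forward) (rule power_mono, assumption, simp)+
    then have "1 / 4 \<le> 1 / (a - b)\<^sup>2 * (h x - a)\<^sup>2 \<or> 1 / 4 \<le> 1 / (a - b)\<^sup>2 * (h x - b)\<^sup>2"
      using False by (auto simp: power_divide field_simps)
    then show "ennreal (1 / 4) \<le> ?i * ennreal ((h x - a)\<^sup>2) \<or> ennreal (1 / 4) \<le> ?i * ennreal ((h x - b)\<^sup>2)"
      by (simp del: ennreal_le_iff flip: ennreal_mult) (auto intro: ennreal_leI)
  qed measurable
  also have "(\<integral>\<^sup>+x. ?i * ennreal ((h x - a)\<^sup>2) \<partial>P) = ?i * (\<integral>\<^sup>+x. ennreal ((h x - a)\<^sup>2) \<partial>P)"
    by (rule nn_integral_cmult) measurable
  also have "(\<integral>\<^sup>+x. ?i * ennreal ((h x - b)\<^sup>2) \<partial>Q) = ?i * (\<integral>\<^sup>+x. ennreal ((h x - b)\<^sup>2) \<partial>Q)"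
    by (rule nn_integral_cmult) measurable
  finally have "?D * ennreal ((1 - d) / 16) \<le> ?D * (?i * ((\<integral>\<^sup>+x. ennreal ((h x - a)\<^sup>2) \<partial>P) + (\<integral>\<^sup>+x. ennreal ((h x - b)\<^sup>2) \<partial>Q)))"
    by (intro mult_left_mono) (simp_all add: distrib_left)
  then have "?D * ennreal ((1 - d) / 16) \<le> (\<integral>\<^sup>+x. ennreal ((h x - a)\<^sup>2) \<partial>P) + (\<integral>\<^sup>+x. ennreal ((h x - b)\<^sup>2) \<partial>Q)"
    unfolding mult.assoc[symmetric] D by simp
  moreover have "ennreal ((a - b)\<^sup>2 * (1 - d) / 16) = ?D * ennreal ((1 - d) / 16)"
    by (subst ennreal_mult'[symmetric]) simp_all
  ultimately show ?thesis by simp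
qed simp

text \<open>Keeps the bump away from its zeros at the ends of the cell and still covers half of the
  cell.\<close>

definition middle_half :: "nat \<Rightarrow> nat \<Rightarrow> real set" where
  "middle_half M k = {(real k + 1/4) / real M .. (real k + 3/4) / real M}"

lemma middle_halfD:
  assumes "x \<in> middle_half M k" "k < M"
  shows "\<lfloor>real M * x\<rfloor> = int k" "x \<in> {0..1}" "(3/16) ^ p \<le> poly (hat p 0) (frac (real M * x))"
proof -
  have M: "0 < real M" using assms by auto
  have x: "real k + 1/4 \<le> real M * x" "real M * x \<le> real k + 3/4"
    using assms M by (auto simp: middle_half_def field_simps)
  show fl: "\<lfloor>real M * x\<rfloor> = int k" using x by (intro floor_unique) auto
  have "real k + 1 \<le> real M" using assms by linarith
  then have "0 \<le> real M * x" "real M * x \<le> real M * 1" using x by linarith+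
  then show "x \<in> {0..1}" using M by (simp add: zero_le_mult_iff)
  have u: "1/4 \<le> frac (real M * x)" "frac (real M * x) \<le> 3/4"
    using x unfolding frac_def fl by auto
  \<comment> \<open>For the fractional part \<open>u\<close> this product equals
    \<open>u * (1 - u) - 3/16\<close>.\<close>
  have "0 \<le> (frac (real M * x) - 1/4) * (3/4 - frac (real M * x))" using u by (intro mult_nonneg_nonneg) auto
  then have "3/16 \<le> frac (real M * x) * (1 - frac (real M * x))" by (simp add: algebra_simps)
  then show "(3/16) ^ p \<le> poly (hat p 0) (frac (real M * x))"
    unfolding poly_hat_0 by (intro power_mono) auto
qed

text \<open>Assouad's lemma, pointwise in \<open>x\<close>: in cell \<open>k\<close> pair the vertices \<open>S\<close> and \<open>insert k S\<close>.\<close>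

lemma cube_risk:
  fixes g :: "data \<Rightarrow> real \<Rightarrow> real" and law :: "nat set \<Rightarrow> data measure"
  assumes M: "1 \<le> M"
    and near: "\<And>S k. k < M \<Longrightarrow> k \<notin> S \<Longrightarrow> near (law S) (law (insert k S)) (d k)"
    and law: "\<And>S. prob_space (law S)" "\<And>S. sets (law S) = sets N"
    and g: "(\<lambda>(D, x). g D x) \<in> borel_measurable (N \<Otimes>\<^sub>M borel)"
    and d: "(\<Sum>k<M. d k) \<le> real M / 2"
    and le: "\<And>S. S \<subseteq> {..<M} \<Longrightarrow> risk (law S) g (bump_sum p M A S) \<le> B"
  shows "ennreal ((3/16) ^ (2 * p) / 32 * A\<^sup>2) \<le> B"
proof -
  define R where "R S x = (\<integral>\<^sup>+D. ennreal ((g D x - bump_sum p M A S x)\<^sup>2) \<partial>law S)" for S x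
  have [measurable]: "R S \<in> borel_measurable borel" for S
    unfolding R_def[abs_def] by (rule risk_eq(2)[OF law g measurable_bump_sum])
  have risk: "risk (law S) g (bump_sum p M A S) = (\<integral>\<^sup>+x. R S x * indicator {0..1} x \<partial>lborel)" for S
    unfolding R_def by (rule risk_eq(1)[OF law g measurable_bump_sum])
  \<comment> \<open>A flip changes the mean by \<open>2 * A\<close> times the bump, in absolute
    value; the square of the 2 and the 16 of \<open>two_point_risk\<close> leave 1/4.\<close>
  define c where "c k = A\<^sup>2 * (3/16) ^ (2 * p) / 4 * (1 - d k)" for k
  have pt: "ennreal (2 ^ (M - 1) * c k) \<le> (\<Sum>S\<in>Pow {..<M}. R S x)" if k: "k < M" and x: "x \<in> middle_half M k" for k x
  proof -
    have pair: "ennreal (c k) \<le> R S x + R (insert k S) x" if S: "S \<in> Pow ({..<M} - {k})" for S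
    proof (cases "d k < 1")
      case True
      have kS: "k \<notin> S" using S by auto
      have "ennreal ((bump_sum p M A S x - bump_sum p M A (insert k S) x)\<^sup>2 * (1 - d k) / 16) \<le> R S x + R (insert k S) x"
        unfolding R_def
      proof (rule two_point_risk[OF near[OF k kS]])
        show "(\<lambda>D. ennreal ((g D x - bump_sum p M A S x)\<^sup>2)) \<in> borel_measurable (law S)"
          by (rule risk_eq(3)[OF law g measurable_bump_sum])
        have "(\<lambda>D. ennreal ((g D x - bump_sum p M A (insert k S) x)\<^sup>2)) \<in> borel_measurable (law (insert k S))"
          by (rule risk_eq(3)[OF law g measurable_bump_sum])
        then show "(\<lambda>D. ennreal ((g D x - bump_sum p M A (insert k S) x)\<^sup>2)) \<in> borel_measurable (law S)"
          by (simp add: measurable_cong_sets[OF law(2) refl])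
      qed
      moreover have "c k \<le> (bump_sum p M A S x - bump_sum p M A (insert k S) x)\<^sup>2 * (1 - d k) / 16"
      proof -
        have "bump_sum p M A S x - bump_sum p M A (insert k S) x = - 2 * A * poly (hat p 0) (frac (real M * x))"
          using kS k by (simp add: bump_sum_eq middle_halfD(1)[OF x k] cell_sign_def)
        then have eq: "(bump_sum p M A S x - bump_sum p M A (insert k S) x)\<^sup>2 = 4 * A\<^sup>2 * (poly (hat p 0) (frac (real M * x)))\<^sup>2"
          by (simp add: power_mult_distrib)
        have "(3/16::real) ^ (2 * p) = ((3/16) ^ p)\<^sup>2" by (simp add: power_mult power_commutes mult.commute power_even_eq)
        also have "\<dots> \<le> (poly (hat p 0) (frac (real M * x)))\<^sup>2"
          by (intro power_mono middle_halfD(3)[OF x k]) auto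
        finally have "(A\<^sup>2 * (1 - d k)) * (3/16) ^ (2 * p) \<le> (A\<^sup>2 * (1 - d k)) * (poly (hat p 0) (frac (real M * x)))\<^sup>2"
          using True by (intro mult_left_mono mult_nonneg_nonneg) auto
        moreover have "c k = (A\<^sup>2 * (1 - d k)) * (3/16) ^ (2 * p) / 4" by (simp add: c_def)
        ultimately show ?thesis unfolding eq by (simp add: mult_ac)
      qed
      ultimately show ?thesis by (meson ennreal_leI order_trans)
    next
      case False
      then have "c k \<le> 0" unfolding c_def by (intro mult_nonneg_nonpos) auto
      then show ?thesis by (simp add: ennreal_neg)
    qed
    \<comment> \<open>The cube splits into \<open>2 ^ (M - 1)\<close> pairs of vertices that differ
      in cell \<open>k\<close> only.\<close>
    have "ennreal (2 ^ (M - 1) * c k) = of_nat (card (Pow ({..<M} - {k}))) * ennreal (c k)"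
      using k by (simp add: card_Pow ennreal_mult' flip: ennreal_power ennreal_numeral)
    also have "\<dots> = (\<Sum>S\<in>Pow ({..<M} - {k}). ennreal (c k))" by simp
    also have "\<dots> \<le> (\<Sum>S\<in>Pow ({..<M} - {k}). R S x + R (insert k S) x)" by (intro sum_mono pair)
    also have "\<dots> = (\<Sum>S\<in>Pow {..<M}. R S x)" using k by (intro sum_Pow_insert[symmetric]) auto
    finally show ?thesis .
  qed
  \<comment> \<open>The weight \<open>1 / (2 * real M)\<close> is the length of a middle half, and
    by the budget the sum of \<open>1 - d k\<close> is at least \<open>real M / 2\<close>. With
    \<open>2 ^ (M - 1)\<close> and the 1/4 in \<open>c\<close> this gives
    \<open>2 ^ M / 32\<close>.\<close>
  have "ennreal (2 ^ M * ((3/16) ^ (2 * p) / 32 * A\<^sup>2)) \<le> ennreal (\<Sum>k<M. 2 ^ (M - 1) * c k * (1 / (2 * real M)))"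
  proof (rule ennreal_leI)
    let ?X = "2 ^ (M - 1) * (A\<^sup>2 * (3/16) ^ (2 * p) / 4) * (1 / (2 * real M))"
    have "(2::real) ^ M = 2 * 2 ^ (M - 1)" using M by (cases M) auto
    then have "2 ^ M * ((3/16) ^ (2 * p) / 32 * A\<^sup>2) = ?X * (real M / 2)"
      using M by simp
    also have "\<dots> \<le> ?X * (\<Sum>k<M. 1 - d k)"
      using d by (intro mult_left_mono) (auto simp: sum_subtractf)
    also have "\<dots> = (\<Sum>k<M. 2 ^ (M - 1) * c k * (1 / (2 * real M)))"
      unfolding sum_distrib_left c_def by (intro sum.cong) simp_all
    finally show "2 ^ M * ((3/16) ^ (2 * p) / 32 * A\<^sup>2) \<le> (\<Sum>k<M. 2 ^ (M - 1) * c k * (1 / (2 * real M)))" .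
  qed
  also have "\<dots> \<le> (\<Sum>k<M. ennreal (2 ^ (M - 1) * c k * (1 / (2 * real M))))" by (rule ennreal_sum_le) simp
  also have "\<dots> = (\<Sum>k<M. \<integral>\<^sup>+x. ennreal (2 ^ (M - 1) * c k) * indicator (middle_half M k) x \<partial>lborel)"
  proof (intro sum.cong refl)
    fix k assume "k \<in> {..<M}"
    have "(real k + 3/4) / real M - (real k + 1/4) / real M = 1 / (2 * real M)"
      using M by (simp add: field_simps)
    moreover have "(real k + 1/4) / real M \<le> (real k + 3/4) / real M" by (intro divide_right_mono) auto
    ultimately have "emeasure lborel (middle_half M k) = ennreal (1 / (2 * real M))"
      unfolding middle_half_def by (simp only: emeasure_lborel_Icc)
    moreover have "ennreal (2 ^ (M - 1) * c k * (1 / (2 * real M))) = ennreal (2 ^ (M - 1) * c k) * ennreal (1 / (2 * real M))"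
      by (rule ennreal_mult'') simp
    ultimately show "ennreal (2 ^ (M - 1) * c k * (1 / (2 * real M))) = (\<integral>\<^sup>+x. ennreal (2 ^ (M - 1) * c k) * indicator (middle_half M k) x \<partial>lborel)"
      by (subst nn_integral_cmult_indicator) (simp_all add: middle_half_def)
  qed
  also have "\<dots> = (\<integral>\<^sup>+x. (\<Sum>k<M. ennreal (2 ^ (M - 1) * c k) * indicator (middle_half M k) x) \<partial>lborel)"
    by (rule nn_integral_sum[symmetric]) (auto simp: middle_half_def)
  also have "\<dots> \<le> (\<integral>\<^sup>+x. (\<Sum>S\<in>Pow {..<M}. R S x * indicator {0..1} x) \<partial>lborel)"
  proof (intro nn_integral_mono)
    fix x :: real
    show "(\<Sum>k<M. ennreal (2 ^ (M - 1) * c k) * indicator (middle_half M k) x) \<le> (\<Sum>S\<in>Pow {..<M}. R S x * indicator {0..1} x)"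
    proof (cases "\<exists>k<M. x \<in> middle_half M k")
      case True
      then obtain k where k: "k < M" "x \<in> middle_half M k" by blast
      have other: "x \<notin> middle_half M k'" if "k' < M" "k' \<noteq> k" for k'
        using middle_halfD(1)[OF k(2,1)] middle_halfD(1)[of x M k'] that by auto
      have "(\<Sum>k<M. ennreal (2 ^ (M - 1) * c k) * indicator (middle_half M k) x)
        = ennreal (2 ^ (M - 1) * c k) * indicator (middle_half M k) x + (\<Sum>k\<in>{..<M} - {k}. ennreal (2 ^ (M - 1) * c k) * indicator (middle_half M k) x)"
        using k by (intro sum.remove) auto
      also have "(\<Sum>k\<in>{..<M} - {k}. ennreal (2 ^ (M - 1) * c k) * indicator (middle_half M k) x) = 0"
        using other by (intro sum.neutral) auto
      also have "ennreal (2 ^ (M - 1) * c k) * indicator (middle_half M k) x + 0 \<le> (\<Sum>S\<in>Pow {..<M}. R S x)"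
        using pt[OF k] k by simp
      also have "\<dots> = (\<Sum>S\<in>Pow {..<M}. R S x * indicator {0..1} x)"
        using middle_halfD(2)[OF k(2,1)] by simp
      finally show ?thesis .
    next
      case False
      then have "(\<Sum>k<M. ennreal (2 ^ (M - 1) * c k) * indicator (middle_half M k) x) = 0"
        by (intro sum.neutral) auto
      then show ?thesis by simp
    qed
  qed
  also have "\<dots> = (\<Sum>S\<in>Pow {..<M}. risk (law S) g (bump_sum p M A S))"
    unfolding risk by (rule nn_integral_sum) simp
  also have "\<dots> \<le> of_nat (card (Pow {..<M})) * B"
    using le by (intro sum_bounded_above) auto
  also have "of_nat (card (Pow {..<M})) = ennreal (2 ^ M)" by (simp add: card_Pow flip: ennreal_power ennreal_numeral)
  finally have "ennreal (2 ^ M) * ennreal ((3/16) ^ (2 * p) / 32 * A\<^sup>2) \<le> ennreal (2 ^ M) * B"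
    by (subst ennreal_mult'[symmetric]) simp_all
  then show ?thesis by (subst (asm) ennreal_mult_le_mult_iff) auto
qed

text \<open>All \<open>K\<close> sources get the same law and the vertex of the target, so a flip
  costs \<open>dt k + real K * ds k\<close>. It is applied with \<open>A' = 0\<close>, for sources
  without information, and with \<open>A' = A\<close>.\<close>

lemma assouad_model:
  fixes g :: "data \<Rightarrow> real \<Rightarrow> real"
  assumes \<eta>t: "prob_space \<eta>t" "sets \<eta>t = sets borel" and \<eta>s: "prob_space \<eta>s" "sets \<eta>s = sets borel"
    and M: "1 \<le> M"
    and t: "cube_sample \<tau> p M A nt mt \<eta>t \<mu>t Xt \<nu>t dt"
    and s: "cube_sample \<tau> p M A' ns ms \<eta>s \<mu>s Xs \<nu>s ds"
    and ht: "\<And>S. hoelder \<alpha>m Lm Mm (bump_sum p M A S)"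
    and hs: "\<And>S. hoelder \<alpha>m Lm Mm (bump_sum p M A' S)"
    and h\<delta>: "\<And>S. hoelder \<alpha>\<delta> L\<delta> M\<delta> (\<lambda>x. bump_sum p M A S x - bump_sum p M A' S x)"
    and d: "(\<Sum>k<M. dt k) + real K * (\<Sum>k<M. ds k) \<le> real M / 2"
    and g: "(\<lambda>(D, x). g D x) \<in> borel_measurable (data_space nt mt ns ms K \<Otimes>\<^sub>M borel)"
  shows "ennreal ((3/16) ^ (2 * p) / 32 * A\<^sup>2) \<le> (SUP P \<in> model_class K \<alpha>m Lm Mm \<alpha>\<delta> L\<delta> M\<delta> \<tau>.
    risk (data_law nt mt ns ms K \<eta>t \<eta>s P) g (target_mean P))" (is "_ \<le> ?B")
proof -
  define P :: "nat set \<Rightarrow> model" where "P S = ((\<mu>t S, Xt S, \<nu>t), (\<lambda>_. \<mu>s S), (\<lambda>_. Xs S), (\<lambda>_. \<nu>s))" for S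
  let ?law = "\<lambda>S. data_law nt mt ns ms K \<eta>t \<eta>s (P S)"
  have vt: "valid_sample \<tau> (\<mu>t S) (Xt S) \<nu>t" "mean_fun (\<mu>t S) (Xt S) = bump_sum p M A S"
    and vs: "valid_sample \<tau> (\<mu>s S) (Xs S) \<nu>s" "mean_fun (\<mu>s S) (Xs S) = bump_sum p M A' S" for S
    using t s by (auto simp: cube_sample_def)
  show ?thesis
  proof (rule cube_risk[where law = ?law and N = "data_space nt mt ns ms K" and d = "\<lambda>k. dt k + real K * ds k"])
    fix S k assume k: "k < M" "k \<notin> S"
    have "near (?law S) (?law (insert k S)) (dt k + (\<Sum>i<K. ds k))"
      unfolding data_law_def P_def prod.case
      using t s k by (intro near_pair near_PiM) (auto simp: cube_sample_def)
    then show "near (?law S) (?law (insert k S)) (dt k + real K * ds k)" by simp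
  next
    fix S
    interpret t: prob_space "sample_law nt mt \<eta>t (\<mu>t S) (Xt S) \<nu>t" by (rule prob_space_sample_law(1)[OF \<eta>t vt(1)])
    interpret s: prob_space "\<Pi>\<^sub>M k\<in>{..<K}. sample_law ns ms \<eta>s (\<mu>s S) (Xs S) \<nu>s"
      by (rule prob_space_PiM) (rule prob_space_sample_law(1)[OF \<eta>s vs(1)])
    interpret ts: pair_prob_space "sample_law nt mt \<eta>t (\<mu>t S) (Xt S) \<nu>t" "\<Pi>\<^sub>M k\<in>{..<K}. sample_law ns ms \<eta>s (\<mu>s S) (Xs S) \<nu>s" ..
    show "prob_space (?law S)"
      unfolding data_law_def P_def prod.case by (rule ts.P.prob_space_axioms)
    show "sets (?law S) = sets (data_space nt mt ns ms K)"
      unfolding data_law_def P_def prod.case data_space_def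
      by (intro sets_pair_measure_cong sets_PiM_cong refl prob_space_sample_law(2)[OF \<eta>t vt(1)] prob_space_sample_law(2)[OF \<eta>s vs(1)])
  next
    show "(\<Sum>k<M. dt k + real K * ds k) \<le> real M / 2"
      using d by (simp add: sum.distrib sum_distrib_left)
  next
    fix S
    have "P S \<in> model_class K \<alpha>m Lm Mm \<alpha>\<delta> L\<delta> M\<delta> \<tau>"
      unfolding model_class_def P_def using vt vs ht hs h\<delta> by simp
    then have "risk (?law S) g (target_mean (P S)) \<le> ?B" by (rule SUP_upper)
    moreover have "target_mean (P S) = bump_sum p M A S" by (simp add: target_mean_def P_def vt)
    ultimately show "risk (?law S) g (bump_sum p M A S) \<le> ?B" by simp
  qed fact+
qed

lemma gaussian_cube_sample:
  assumes \<eta>: "prob_space \<eta>" "sets \<eta> = sets borel" and \<tau>: "0 < \<tau>" and A: "0 \<le> A"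
  obtains \<mu> X \<nu> d where "cube_sample \<tau> p M A n m \<eta> \<mu> X \<nu> d" "(\<Sum>k<M. d k) \<le> real n * real m * A\<^sup>2 / \<tau>\<^sup>2"
proof
  interpret \<eta>: prob_space \<eta> by fact
  let ?c = "\<lambda>k. {x. \<lfloor>real M * x\<rfloor> = int k}"
  let ?d = "\<lambda>k. real n * real m * A\<^sup>2 / \<tau>\<^sup>2 * measure \<eta> (?c k)"
  show "cube_sample \<tau> p M A n m \<eta> (\<lambda>_. return borel 0) (\<lambda>S \<omega>. bump_sum p M A S) (gaussian \<tau>) ?d"
    unfolding cube_sample_def
    by (intro conjI allI impI valid_sample_gaussian[OF \<tau> measurable_bump_sum] near_sample_law_gaussian[OF \<eta> \<tau> A])
  have c: "?c k \<in> sets \<eta>" for k using sets_cell \<eta> by simp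
  have "(\<Sum>k<M. measure \<eta> (?c k)) = measure \<eta> (\<Union>k<M. ?c k)"
    using c by (intro \<eta>.finite_measure_finite_Union[symmetric]) (auto simp: disjoint_family_on_def)
  then have "(\<Sum>k<M. measure \<eta> (?c k)) \<le> 1" using \<eta>.prob_le_1 by simp
  then have "real n * real m * A\<^sup>2 / \<tau>\<^sup>2 * (\<Sum>k<M. measure \<eta> (?c k)) \<le> real n * real m * A\<^sup>2 / \<tau>\<^sup>2 * 1"
    by (intro mult_left_mono) auto
  then show "(\<Sum>k<M. ?d k) \<le> real n * real m * A\<^sup>2 / \<tau>\<^sup>2" by (simp add: sum_distrib_left)
qed

text \<open>The curves get the largest amplitude that \<open>valid_sample_coin_curve\<close> allows,
  \<open>\<tau> / 4\<close>; the bias \<open>4 * A / \<tau>\<close> then produces the mean amplitude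
  \<open>A\<close>.\<close>

lemma coin_cube_sample:
  assumes \<eta>: "prob_space \<eta>" "sets \<eta> = sets borel" and \<tau>: "0 < \<tau>" and A: "0 \<le> A" "4 * A \<le> \<tau>"
  obtains \<mu> X \<nu> d where "cube_sample \<tau> p M A n m \<eta> \<mu> X \<nu> d" "(\<Sum>k<M. d k) = real M * (real n * (16 * A\<^sup>2 / \<tau>\<^sup>2))"
proof
  define s where "s = 4 * A / \<tau>"
  have s: "0 \<le> s" "s \<le> 1" "\<bar>s\<bar> \<le> 1" and As: "A = \<tau> / 4 * s" using A \<tau> by (auto simp: s_def)
  have \<tau>4: "0 \<le> \<tau> / 4" "4 * (\<tau> / 4) \<le> \<tau>" using \<tau> by auto
  show "cube_sample \<tau> p M A n m \<eta> (\<lambda>S. distr (coins M s S) borel (encode M)) (\<lambda>_. coin_curve p M (\<tau> / 4))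
    (return borel 0) (\<lambda>_. real n * s\<^sup>2)"
    unfolding cube_sample_def As
    by (intro conjI allI impI valid_sample_coin_curve[OF \<tau> \<tau>4 s(1,2)] mean_fun_coin_curve[OF s(3)]
      near_sample_law_coin[OF \<eta> \<tau> \<tau>4 s(1,2)])
  show "(\<Sum>k<M. real n * s\<^sup>2) = real M * (real n * (16 * A\<^sup>2 / \<tau>\<^sup>2))"
    by (simp add: s_def power_divide power_mult_distrib)
qed

section \<open>Number of cells and arithmetic of the rates\<close>

text \<open>With amplitude \<open>M powr - \<alpha>\<close> the total cost is of order
  \<open>N * M powr - (2 * \<alpha>)\<close> and may be of order \<open>M\<close>. The two balance
  at \<open>x = N powr (1 / (2 * \<alpha> + 1))\<close>. Rounding \<open>x\<close> up keeps the
  budget, and \<open>M \<le> 2 * x\<close> limits the loss to the factor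
  \<open>2 powr - (2 * \<alpha>)\<close>.\<close>

lemma bandwidth:
  fixes N \<alpha> :: real
  assumes "0 < \<alpha>" "1 \<le> N"
  obtains M :: nat where "1 \<le> M" "N * real M powr (- (2 * \<alpha>)) \<le> real M"
    "2 powr (- (2 * \<alpha>)) * N powr (- (2 * \<alpha>) / (2 * \<alpha> + 1)) \<le> real M powr (- (2 * \<alpha>))"
proof -
  define x where "x = N powr (1 / (2 * \<alpha> + 1))"
  have x: "1 \<le> x" unfolding x_def using assms by (intro ge_one_powr_ge_zero) auto
  define M where "M = nat \<lceil>x\<rceil>"
  have M: "x \<le> real M" "real M \<le> 2 * x" "1 \<le> M" using x unfolding M_def by linarith+
  have "N = x powr (2 * \<alpha> + 1)" unfolding x_def using assms by (simp add: powr_powr)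
  also have "\<dots> \<le> real M powr (2 * \<alpha> + 1)" using x M assms by (intro powr_mono2) auto
  finally have "N * real M powr (- (2 * \<alpha>)) \<le> real M powr (2 * \<alpha> + 1) * real M powr (- (2 * \<alpha>))"
    by (intro mult_right_mono) auto
  also have "\<dots> = real M" using M by (simp flip: powr_add)
  finally have 1: "N * real M powr (- (2 * \<alpha>)) \<le> real M" .
  have "2 powr (- (2 * \<alpha>)) * N powr (- (2 * \<alpha>) / (2 * \<alpha> + 1)) = (2 * x) powr (- (2 * \<alpha>))"
    unfolding x_def using assms by (simp add: powr_mult powr_powr)
  also have "\<dots> \<le> real M powr (- (2 * \<alpha>))"
    using M x assms by (intro powr_mono2') auto
  finally show ?thesis using 1 M that by blast
qed

text \<open>If \<open>am \<le> t\<close>, the first entry is small. Otherwise the three minima force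
  \<open>ad\<close>, \<open>as\<close> and \<open>ks\<close> below \<open>t\<close>, and the four
  terms of the second entry account for the factor 4.\<close>

lemma min_rate_le:
  fixes am ad as ks r l l' L t :: real
  assumes "min am ad \<le> t" "min am as \<le> t" "min am ks \<le> t" "r \<le> t" "0 \<le> t"
    and L: "1 \<le> L" "0 \<le> l" "l \<le> L" "0 \<le> l'" "l' \<le> L"
  shows "min (l * am + r) (l' * ad + r + l * as + ks) \<le> 4 * L * t"
proof -
  have le: "w * z \<le> L * t" if "0 \<le> w" "w \<le> L" "z \<le> t" for w z
  proof -
    have "w * z \<le> w * t" using that by (intro mult_left_mono) auto
    also have "\<dots> \<le> L * t" using that assms by (intro mult_right_mono) auto
    finally show ?thesis .
  qed
  have t: "0 \<le> L * t" "z \<le> t \<Longrightarrow> z \<le> L * t" for z using le[of 1 z] L assms(5) by auto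
  show ?thesis
  proof (cases "am \<le> t")
    case True
    then have "l * am + r \<le> L * t + L * t" using assms by (intro add_mono le t) auto
    then show ?thesis using t(1) by (simp add: min_le_iff_disj)
  next
    case False
    then have "ad \<le> t" "as \<le> t" "ks \<le> t" using assms by (auto simp: min_def split: if_splits)
    then have "l' * ad + r + l * as + ks \<le> L * t + L * t + L * t + L * t" using assms by (intro add_mono le t) auto
    then show ?thesis by (simp add: min_le_iff_disj)
  qed
qed

subsection \<open>The lower bound\<close>

theorem theorem3p3:
  fixes \<alpha>m \<alpha>\<delta> Lm L\<delta> Mm M\<delta> \<tau> :: real and \<eta>t \<eta>s :: "real measure"
  assumes "\<alpha>m > 0" "\<alpha>\<delta> > 0" "Lm > 0" "L\<delta> > 0" "Mm > 0" "M\<delta> > 0" "\<tau> > 0"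
    and "prob_space \<eta>t" "sets \<eta>t = sets borel" "emeasure \<eta>t {0..1} = 1"
    and "prob_space \<eta>s" "sets \<eta>s = sets borel" "emeasure \<eta>s {0..1} = 1"
  shows "\<exists>c>0. \<forall>nt mt ns ms K. nt \<ge> 1 \<longrightarrow> mt \<ge> 1 \<longrightarrow> ns \<ge> 1 \<longrightarrow> ms \<ge> 1 \<longrightarrow> K \<ge> 1 \<longrightarrow>
     (\<forall>g :: data \<Rightarrow> real \<Rightarrow> real.
        (\<lambda>(D, x). g D x) \<in> borel_measurable (data_space nt mt ns ms K \<Otimes>\<^sub>M borel) \<longrightarrow>
        ennreal (c * min
           (Lm powr (2 / (2 * \<alpha>m + 1)) * (real mt * real nt) powr (- (2 * \<alpha>m) / (2 * \<alpha>m + 1))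
              + 1 / real nt)
           (L\<delta> powr (2 / (2 * \<alpha>\<delta> + 1)) * (real mt * real nt) powr (- (2 * \<alpha>\<delta>) / (2 * \<alpha>\<delta> + 1))
              + 1 / real nt
              + Lm powr (2 / (2 * \<alpha>m + 1)) * (real K * real ms * real ns) powr (- (2 * \<alpha>m) / (2 * \<alpha>m + 1))
              + 1 / (real K * real ns)))
        \<le> (SUP P \<in> model_class K \<alpha>m Lm Mm \<alpha>\<delta> L\<delta> M\<delta> \<tau>.
              risk (data_law nt mt ns ms K \<eta>t \<eta>s P) g (target_mean P)))"
proof -
  note \<alpha> = assms(1,2) and \<tau> = assms(7) and \<eta>t = assms(8,9) and \<eta>s = assms(11,12)
  \<comment> \<open>One exponent serves both classes, since for zero source means the same bumps are
    target mean and difference function.\<close>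
  define p where "p = omega_int \<alpha>m + omega_int \<alpha>\<delta> + 3"
  obtain Bm where Bm: "0 < Bm" "\<And>M A L Mx \<theta>. 1 \<le> M \<Longrightarrow> 0 \<le> A \<Longrightarrow> (\<And>k. \<bar>\<theta> k\<bar> \<le> 1) \<Longrightarrow>
      A * real M powr \<alpha>m * Bm \<le> L \<Longrightarrow> A * Bm \<le> Mx \<Longrightarrow> hoelder \<alpha>m L Mx (\<lambda>x. A * bumps p 0 \<theta> (real M * x))"
    using hoelder_bumps[OF \<alpha>(1), of p] by (auto simp: p_def)
  obtain B\<delta> where B\<delta>: "0 < B\<delta>" "\<And>M A L Mx \<theta>. 1 \<le> M \<Longrightarrow> 0 \<le> A \<Longrightarrow> (\<And>k. \<bar>\<theta> k\<bar> \<le> 1) \<Longrightarrow>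
      A * real M powr \<alpha>\<delta> * B\<delta> \<le> L \<Longrightarrow> A * B\<delta> \<le> Mx \<Longrightarrow> hoelder \<alpha>\<delta> L Mx (\<lambda>x. A * bumps p 0 \<theta> (real M * x))"
    using hoelder_bumps[OF \<alpha>(2), of p] by (auto simp: p_def)
  \<comment> \<open>The first four quotients put the bumps into the two classes. The last makes
    \<open>16 * c0\<^sup>2 / \<tau>\<^sup>2\<close> at most 1/4, which keeps the coin cost within
    half of the budget.\<close>
  define c0 where "c0 = Min {Lm / Bm, Mm / Bm, L\<delta> / B\<delta>, M\<delta> / B\<delta>, \<tau> / 8}"
  have c0: "0 < c0" unfolding c0_def using assms Bm(1) B\<delta>(1) by (subst Min_gr_iff) auto
  have "c0 \<le> Lm / Bm" "c0 \<le> Mm / Bm" "c0 \<le> L\<delta> / B\<delta>" "c0 \<le> M\<delta> / B\<delta>" and c0\<tau>: "c0 \<le> \<tau> / 8"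
    unfolding c0_def by (rule Min_le; simp)+
  then have c0B: "c0 * Bm \<le> Lm" "c0 * Bm \<le> Mm" "c0 * B\<delta> \<le> L\<delta>" "c0 * B\<delta> \<le> M\<delta>"
    using Bm(1) B\<delta>(1) by (simp_all add: pos_le_divide_eq)
  have c0\<tau>2: "c0\<^sup>2 / \<tau>\<^sup>2 \<le> 1 / 64"
  proof -
    have "c0\<^sup>2 \<le> (\<tau> / 8)\<^sup>2" using c0 c0\<tau> by (intro power_mono) auto
    then show ?thesis using \<tau> by (simp add: power_divide divide_simps)
  qed
  have hm: "hoelder \<alpha>m Lm Mm (bump_sum p M (c0 * r) S)" if "1 \<le> M" "0 \<le> r" "r \<le> 1" "r * real M powr \<alpha>m \<le> 1" for M r S
    unfolding bump_sum_def
  proof (rule Bm(2)[OF that(1)])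
    have "(r * real M powr \<alpha>m) * (c0 * Bm) \<le> 1 * (c0 * Bm)" "r * (c0 * Bm) \<le> 1 * (c0 * Bm)"
      using that c0 Bm(1) by (auto intro!: mult_right_mono)
    then show "c0 * r * real M powr \<alpha>m * Bm \<le> Lm" "c0 * r * Bm \<le> Mm"
      using c0B by (auto simp: mult_ac)
  qed (use that c0 abs_cell_sign_le in auto)
  have h\<delta>: "hoelder \<alpha>\<delta> L\<delta> M\<delta> (bump_sum p M (c0 * r) S)" if "1 \<le> M" "0 \<le> r" "r \<le> 1" "r * real M powr \<alpha>\<delta> \<le> 1" for M r S
    unfolding bump_sum_def
  proof (rule B\<delta>(2)[OF that(1)])
    have "(r * real M powr \<alpha>\<delta>) * (c0 * B\<delta>) \<le> 1 * (c0 * B\<delta>)" "r * (c0 * B\<delta>) \<le> 1 * (c0 * B\<delta>)"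
      using that c0 B\<delta>(1) by (auto intro!: mult_right_mono)
    then show "c0 * r * real M powr \<alpha>\<delta> * B\<delta> \<le> L\<delta>" "c0 * r * B\<delta> \<le> M\<delta>"
      using c0B by (auto simp: mult_ac)
  qed (use that c0 abs_cell_sign_le in auto)
  define c1 where "c1 = (3/16) ^ (2 * p) / 32 * c0\<^sup>2"
  have c1: "0 < c1" using c0 by (simp add: c1_def)
  \<comment> \<open>The smaller of the loss factors of \<open>bandwidth\<close> at the two exponents
    it is applied to, \<open>\<alpha>m\<close> and the maximum.\<close>
  define e where "e = 2 powr (- (2 * max \<alpha>m \<alpha>\<delta>))"
  have e: "0 < e" "e \<le> 1" "e \<le> 2 powr (- (2 * \<alpha>m))"
    using \<alpha> powr_mono[of "- (2 * max \<alpha>m \<alpha>\<delta>)" 0 2] by (auto simp: e_def intro!: powr_mono)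
  \<comment> \<open>The radii are constants of the problem, so an upper bound for their powers is
    enough.\<close>
  define \<Lambda> where "\<Lambda> = Max {1, Lm powr (2 / (2 * \<alpha>m + 1)), L\<delta> powr (2 / (2 * \<alpha>\<delta> + 1))}"
  have \<Lambda>: "1 \<le> \<Lambda>" "Lm powr (2 / (2 * \<alpha>m + 1)) \<le> \<Lambda>" "L\<delta> powr (2 / (2 * \<alpha>\<delta> + 1)) \<le> \<Lambda>"
    unfolding \<Lambda>_def by (rule Max_ge; simp)+
  show ?thesis
  proof (intro exI[of _ "c1 * e / (4 * \<Lambda>)"] conjI allI impI)
    show "0 < c1 * e / (4 * \<Lambda>)" using c1 e \<Lambda> by simp
    fix nt mt ns ms K :: nat and g :: "data \<Rightarrow> real \<Rightarrow> real"
    assume pos: "nt \<ge> 1" "mt \<ge> 1" "ns \<ge> 1" "ms \<ge> 1" "K \<ge> 1"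
      and g: "(\<lambda>(D, x). g D x) \<in> borel_measurable (data_space nt mt ns ms K \<Otimes>\<^sub>M borel)"
    let ?V = "SUP P \<in> model_class K \<alpha>m Lm Mm \<alpha>\<delta> L\<delta> M\<delta> \<tau>. risk (data_law nt mt ns ms K \<eta>t \<eta>s P) g (target_mean P)"
    define Nt where "Nt = real mt * real nt"
    define Ns where "Ns = real K * real ms * real ns"
    have nt1: "1 \<le> real nt" and Nt: "1 \<le> Nt" and Ns: "1 \<le> Ns"
      using pos by (simp_all add: Nt_def Ns_def Suc_le_eq flip: of_nat_mult)
    have amp: "ennreal (c1 * r\<^sup>2) = ennreal ((3/16) ^ (2 * p) / 32 * (c0 * r)\<^sup>2)" for r
      by (simp add: c1_def power_mult_distrib mult_ac)
    \<comment> \<open>This and the next estimate keep the cost of the target, and that of all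
      sources together, at a quarter of \<open>M\<close> each.\<close>
    have gauss: "a * b * (c0 * r)\<^sup>2 / \<tau>\<^sup>2 \<le> x / 4" if "a * b * r\<^sup>2 \<le> x" "0 \<le> a * b" for a b r x :: real
    proof -
      have "a * b * (c0 * r)\<^sup>2 / \<tau>\<^sup>2 = (a * b * r\<^sup>2) * (c0\<^sup>2 / \<tau>\<^sup>2)" by (simp add: power_mult_distrib)
      also have "\<dots> \<le> (a * b * r\<^sup>2) * (1 / 64)"
        using c0\<tau>2 by (intro mult_left_mono mult_nonneg_nonneg[OF that(2)]) auto
      finally show ?thesis using that mult_nonneg_nonneg[OF that(2) zero_le_power2[of r]] by linarith
    qed
    have coin: "n * (16 * (c0 * r)\<^sup>2 / \<tau>\<^sup>2) \<le> 1 / 4" if "n * r\<^sup>2 \<le> 1" "0 \<le> n" for n r :: real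
    proof -
      have "n * (16 * (c0 * r)\<^sup>2 / \<tau>\<^sup>2) = 16 * (n * r\<^sup>2) * (c0\<^sup>2 / \<tau>\<^sup>2)" by (simp add: power_mult_distrib)
      also have "\<dots> \<le> 16 * (n * r\<^sup>2) * (1 / 64)" using c0\<tau>2 that(2) by (intro mult_left_mono mult_nonneg_nonneg) auto
      finally show ?thesis using that by linarith
    qed
    have coin_ok: "0 \<le> c0 * r" "4 * (c0 * r) \<le> \<tau>" if "0 \<le> r" "r \<le> 1" for r
    proof -
      have "c0 * r \<le> c0 * 1" using c0 that by (intro mult_left_mono) auto
      then show "4 * (c0 * r) \<le> \<tau>" using c0\<tau> \<tau> by linarith
    qed (use c0 that in auto)

    have bump0: "bump_sum p M 0 S = (\<lambda>_. 0)" for M S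
      by (simp add: bump_sum_def fun_eq_iff)
    have diff0: "hoelder \<alpha>\<delta> L\<delta> M\<delta> (\<lambda>x. bump_sum p M A S x - bump_sum p M A S x)" if "1 \<le> M" for M A S
      using h\<delta>[OF that, of 0 S] by (simp add: bump0)
    have zero: "hoelder \<alpha>m Lm Mm (\<lambda>_. 0)"
      using hm[of 1 0 "{}"] by (simp add: bump0)

    \<comment> \<open>Target curves are coin curves (one cell), sources carry no information.\<close>
    have V1: "ennreal (c1 * (1 / real nt)) \<le> ?V"
    proof -
      \<comment> \<open>Chosen so that \<open>nt * r\<^sup>2 = 1\<close>. With a single cell,
        smoothness asks for no more than \<open>r \<le> 1\<close>.\<close>
      define r where "r = 1 / sqrt (real nt)"
      have r: "0 \<le> r" "r \<le> 1" "r\<^sup>2 = 1 / real nt" using nt1 by (auto simp: r_def power_divide)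
      obtain \<mu>t Xt \<nu>t dt where t: "cube_sample \<tau> p 1 (c0 * r) nt mt \<eta>t \<mu>t Xt \<nu>t dt"
        "(\<Sum>k<1. dt k) = real 1 * (real nt * (16 * (c0 * r)\<^sup>2 / \<tau>\<^sup>2))"
        using coin_cube_sample[OF \<eta>t \<tau> coin_ok[OF r(1,2)]] by blast
      obtain \<mu>s Xs \<nu>s ds where s: "cube_sample \<tau> p 1 0 ns ms \<eta>s \<mu>s Xs \<nu>s ds"
        "(\<Sum>k<1. ds k) \<le> real ns * real ms * 0\<^sup>2 / \<tau>\<^sup>2"
        using gaussian_cube_sample[OF \<eta>s \<tau> order_refl] by blast
      have "real nt * r\<^sup>2 \<le> 1" using r(3) nt1 by simp
      then have dt: "(\<Sum>k<1. dt k) \<le> 1 / 4" using t(2) coin by simp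
      have "ennreal ((3/16) ^ (2 * p) / 32 * (c0 * r)\<^sup>2) \<le> ?V"
      proof (rule assouad_model[OF \<eta>t \<eta>s order_refl t(1) s(1)])
        have "(\<Sum>k<1. ds k) \<le> 0" using s(2) by simp
        then have "real K * (\<Sum>k<1. ds k) \<le> 0" by (intro mult_nonneg_nonpos) auto
        then show "(\<Sum>k<1. dt k) + real K * (\<Sum>k<1. ds k) \<le> real 1 / 2" using dt by simp
      qed (use r c0 hm h\<delta> zero g in \<open>auto simp: bump0\<close>)
      then show ?thesis by (simp only: amp[symmetric] r(3))
    qed

    \<comment> \<open>Target is a noisy regression, sources carry no information.\<close>
    have V2: "ennreal (c1 * r\<^sup>2) \<le> ?V"
      if M: "1 \<le> M" and r: "0 \<le> r" "r \<le> 1" "r * real M powr \<alpha>m \<le> 1" "r * real M powr \<alpha>\<delta> \<le> 1" "Nt * r\<^sup>2 \<le> real M" for M r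
    proof -
      obtain \<mu>t Xt \<nu>t dt where t: "cube_sample \<tau> p M (c0 * r) nt mt \<eta>t \<mu>t Xt \<nu>t dt"
        "(\<Sum>k<M. dt k) \<le> real nt * real mt * (c0 * r)\<^sup>2 / \<tau>\<^sup>2"
        using gaussian_cube_sample[OF \<eta>t \<tau> coin_ok(1)[OF r(1,2)]] by blast
      obtain \<mu>s Xs \<nu>s ds where s: "cube_sample \<tau> p M 0 ns ms \<eta>s \<mu>s Xs \<nu>s ds"
        "(\<Sum>k<M. ds k) \<le> real ns * real ms * 0\<^sup>2 / \<tau>\<^sup>2"
        using gaussian_cube_sample[OF \<eta>s \<tau> order_refl] by blast
      have dt: "(\<Sum>k<M. dt k) \<le> real M / 4"
        by (rule order_trans[OF t(2) gauss]) (use r(5) in \<open>simp_all add: Nt_def mult_ac\<close>)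
      show ?thesis
        unfolding amp
      proof (rule assouad_model[OF \<eta>t \<eta>s M t(1) s(1)])
        have "(\<Sum>k<M. ds k) \<le> 0" using s(2) by simp
        then have "real K * (\<Sum>k<M. ds k) \<le> 0" by (intro mult_nonneg_nonpos) auto
        then show "(\<Sum>k<M. dt k) + real K * (\<Sum>k<M. ds k) \<le> real M / 2" using dt by simp
      qed (use M r hm h\<delta> zero g in \<open>auto simp: bump0\<close>)
    qed

    \<comment> \<open>All samples are noisy regressions with the same mean.\<close>
    have V3: "ennreal (c1 * r\<^sup>2) \<le> ?V"
      if M: "1 \<le> M" and r: "0 \<le> r" "r \<le> 1" "r * real M powr \<alpha>m \<le> 1" "Nt * r\<^sup>2 \<le> real M" "Ns * r\<^sup>2 \<le> real M" for M r
    proof -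
      obtain \<mu>t Xt \<nu>t dt where t: "cube_sample \<tau> p M (c0 * r) nt mt \<eta>t \<mu>t Xt \<nu>t dt"
        "(\<Sum>k<M. dt k) \<le> real nt * real mt * (c0 * r)\<^sup>2 / \<tau>\<^sup>2"
        using gaussian_cube_sample[OF \<eta>t \<tau> coin_ok(1)[OF r(1,2)]] by blast
      obtain \<mu>s Xs \<nu>s ds where s: "cube_sample \<tau> p M (c0 * r) ns ms \<eta>s \<mu>s Xs \<nu>s ds"
        "(\<Sum>k<M. ds k) \<le> real ns * real ms * (c0 * r)\<^sup>2 / \<tau>\<^sup>2"
        using gaussian_cube_sample[OF \<eta>s \<tau> coin_ok(1)[OF r(1,2)]] by blast
      have dt: "(\<Sum>k<M. dt k) \<le> real M / 4"
        by (rule order_trans[OF t(2) gauss]) (use r(4) in \<open>simp_all add: Nt_def mult_ac\<close>)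
      have "real K * (\<Sum>k<M. ds k) \<le> real K * (real ns * real ms * (c0 * r)\<^sup>2 / \<tau>\<^sup>2)"
        using s(2) by (intro mult_left_mono) auto
      also have "\<dots> = (real K * real ms) * real ns * (c0 * r)\<^sup>2 / \<tau>\<^sup>2" by simp
      also have "\<dots> \<le> real M / 4" using gauss r(5) by (simp add: Ns_def)
      finally have ds: "real K * (\<Sum>k<M. ds k) \<le> real M / 4" .
      show ?thesis
        unfolding amp
        by (rule assouad_model[OF \<eta>t \<eta>s M t(1) s(1) hm[OF M r(1-3)] hm[OF M r(1-3)] diff0[OF M] _ g])
          (use dt ds in linarith)
    qed

    \<comment> \<open>Target is a noisy regression, source curves are coin curves with the same mean.\<close>
    have V4: "ennreal (c1 * r\<^sup>2) \<le> ?V"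
      if M: "1 \<le> M" and r: "0 \<le> r" "r \<le> 1" "r * real M powr \<alpha>m \<le> 1" "Nt * r\<^sup>2 \<le> real M" "real K * real ns * r\<^sup>2 \<le> 1" for M r
    proof -
      obtain \<mu>t Xt \<nu>t dt where t: "cube_sample \<tau> p M (c0 * r) nt mt \<eta>t \<mu>t Xt \<nu>t dt"
        "(\<Sum>k<M. dt k) \<le> real nt * real mt * (c0 * r)\<^sup>2 / \<tau>\<^sup>2"
        using gaussian_cube_sample[OF \<eta>t \<tau> coin_ok(1)[OF r(1,2)]] by blast
      obtain \<mu>s Xs \<nu>s ds where s: "cube_sample \<tau> p M (c0 * r) ns ms \<eta>s \<mu>s Xs \<nu>s ds"
        "(\<Sum>k<M. ds k) = real M * (real ns * (16 * (c0 * r)\<^sup>2 / \<tau>\<^sup>2))"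
        using coin_cube_sample[OF \<eta>s \<tau> coin_ok[OF r(1,2)]] by blast
      have dt: "(\<Sum>k<M. dt k) \<le> real M / 4"
        by (rule order_trans[OF t(2) gauss]) (use r(4) in \<open>simp_all add: Nt_def mult_ac\<close>)
      have "real K * (\<Sum>k<M. ds k) = real M * ((real K * real ns) * (16 * (c0 * r)\<^sup>2 / \<tau>\<^sup>2))"
        unfolding s(2) by (simp add: mult_ac)
      also have "\<dots> \<le> real M * (1 / 4)" using r(5) by (intro mult_left_mono coin) auto
      finally have ds: "real K * (\<Sum>k<M. ds k) \<le> real M / 4" by simp
      show ?thesis
        unfolding amp
        by (rule assouad_model[OF \<eta>t \<eta>s M t(1) s(1) hm[OF M r(1-3)] hm[OF M r(1-3)] diff0[OF M] _ g])
          (use dt ds in linarith)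
    qed

    \<comment> \<open>With \<open>M\<close> cells, the amplitude \<open>M powr - \<beta>\<close> is
      admissible for every smoothness \<open>\<alpha>' \<le> \<beta>\<close>.\<close>
    have amplitude: "real M powr - \<beta> \<le> 1" "real M powr - \<beta> * real M powr \<alpha>' \<le> 1" "(real M powr - \<beta>)\<^sup>2 = real M powr - (2 * \<beta>)"
      if "1 \<le> M" "0 < \<alpha>'" "\<alpha>' \<le> \<beta>" for M :: nat and \<alpha>' \<beta> :: real
      using that powr_mono[of "- \<beta>" 0 "real M"] powr_mono[of "\<alpha>' - \<beta>" 0 "real M"]
      by (auto simp: power2_eq_square simp flip: powr_add)

    define am where "am N = N powr (- (2 * \<alpha>m) / (2 * \<alpha>m + 1))" for N
    define ad where "ad = Nt powr (- (2 * \<alpha>\<delta>) / (2 * \<alpha>\<delta> + 1))"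
    have scale: "ennreal (c1 * e * x) \<le> ?V" if "ennreal (c1 * y) \<le> ?V" "e * x \<le> y" for x y
    proof -
      have "c1 * e * x \<le> c1 * y" using that(2) c1 by (simp add: mult.assoc)
      then show ?thesis using that(1) by (meson ennreal_leI order_trans)
    qed
    have W1: "ennreal (c1 * e * (1 / real nt)) \<le> ?V"
      using e nt1 by (intro scale[OF V1] mult_left_le_one_le) auto
    have W2: "ennreal (c1 * e * min (am Nt) ad) \<le> ?V"
    proof -
      \<comment> \<open>The target mean is also the difference from the zero source means, so the
        larger exponent decides; its rate is one of the two in the minimum.\<close>
      let ?\<alpha> = "max \<alpha>m \<alpha>\<delta>"
      obtain M :: nat where M: "1 \<le> M" "Nt * real M powr (- (2 * ?\<alpha>)) \<le> real M"
        "2 powr (- (2 * ?\<alpha>)) * Nt powr (- (2 * ?\<alpha>) / (2 * ?\<alpha> + 1)) \<le> real M powr (- (2 * ?\<alpha>))"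
        by (rule bandwidth[of ?\<alpha> Nt]) (use \<alpha> Nt in auto)
      note a = amplitude[OF M(1), of \<alpha>m ?\<alpha>] amplitude[OF M(1), of \<alpha>\<delta> ?\<alpha>]
      have V: "ennreal (c1 * (real M powr - ?\<alpha>)\<^sup>2) \<le> ?V"
        using M a \<alpha> by (intro V2[OF M(1)]) auto
      have "e * min (am Nt) ad \<le> e * Nt powr (- (2 * ?\<alpha>) / (2 * ?\<alpha> + 1))"
        using e by (intro mult_left_mono) (auto simp: am_def ad_def max_def)
      also have "\<dots> \<le> (real M powr - ?\<alpha>)\<^sup>2"
        using M(3) a(3) \<alpha> by (simp add: e_def)
      finally have "e * min (am Nt) ad \<le> (real M powr - ?\<alpha>)\<^sup>2" .
      from scale[OF V this] show ?thesis .
    qed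
    have W3: "ennreal (c1 * e * min (am Nt) (am Ns)) \<le> ?V"
    proof -
      \<comment> \<open>The budgets of target and sources have to hold for the same
        \<open>M\<close>; the rate at the larger size is one of the two in the minimum.\<close>
      let ?N = "max Nt Ns"
      obtain M :: nat where M: "1 \<le> M" "?N * real M powr (- (2 * \<alpha>m)) \<le> real M"
        "2 powr (- (2 * \<alpha>m)) * ?N powr (- (2 * \<alpha>m) / (2 * \<alpha>m + 1)) \<le> real M powr (- (2 * \<alpha>m))"
        by (rule bandwidth[of \<alpha>m ?N]) (use \<alpha> Nt in auto)
      note a = amplitude[OF M(1) \<alpha>(1) order_refl]
      have "Nt * real M powr (- (2 * \<alpha>m)) \<le> ?N * real M powr (- (2 * \<alpha>m))"
        "Ns * real M powr (- (2 * \<alpha>m)) \<le> ?N * real M powr (- (2 * \<alpha>m))"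
        by (intro mult_right_mono; simp)+
      then have "ennreal (c1 * (real M powr - \<alpha>m)\<^sup>2) \<le> ?V"
        using M(2) a by (intro V3[OF M(1)]) auto
      moreover have "e * min (am Nt) (am Ns) \<le> (real M powr - \<alpha>m)\<^sup>2"
      proof -
        have "e * min (am Nt) (am Ns) \<le> 2 powr (- (2 * \<alpha>m)) * am ?N"
          using e by (intro mult_mono) (auto simp: am_def max_def)
        also have "\<dots> \<le> (real M powr - \<alpha>m)\<^sup>2"
          using M(3) a(3) by (simp add: am_def)
        finally show ?thesis .
      qed
      ultimately show ?thesis by (rule scale)
    qed
    have W4: "ennreal (c1 * e * min (am Nt) (1 / (real K * real ns))) \<le> ?V"
    proof -
      obtain M :: nat where M: "1 \<le> M" "Nt * real M powr (- (2 * \<alpha>m)) \<le> real M"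
        "2 powr (- (2 * \<alpha>m)) * Nt powr (- (2 * \<alpha>m) / (2 * \<alpha>m + 1)) \<le> real M powr (- (2 * \<alpha>m))"
        by (rule bandwidth[OF \<alpha>(1) Nt])
      note a = amplitude[OF M(1) \<alpha>(1) order_refl]
      \<comment> \<open>\<open>M\<close> is set by the target alone, because the coin cost per cell
        does not depend on it. If the coins of the sources would reveal the signs, the squared
        amplitude is lowered to \<open>1 / (K ns)\<close> instead.\<close>
      define q where "q = min (real M powr - (2 * \<alpha>m)) (1 / (real K * real ns))"
      have q: "0 \<le> q" "q \<le> (real M powr - \<alpha>m)\<^sup>2" "q \<le> 1 / (real K * real ns)" "q \<le> real M powr - (2 * \<alpha>m)"
        unfolding q_def a(3) by auto
      have sq: "sqrt q \<le> real M powr - \<alpha>m" using q(2) by (intro real_le_lsqrt) auto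
      have "ennreal (c1 * (sqrt q)\<^sup>2) \<le> ?V"
      proof (rule V4[OF M(1)])
        show "0 \<le> sqrt q" using q by simp
        show "sqrt q \<le> 1" using sq a(1) by linarith
        have "sqrt q * real M powr \<alpha>m \<le> real M powr - \<alpha>m * real M powr \<alpha>m" using sq by (intro mult_right_mono) auto
        then show "sqrt q * real M powr \<alpha>m \<le> 1" using a(2) by linarith
        have "Nt * q \<le> Nt * real M powr - (2 * \<alpha>m)" using q Nt by (intro mult_left_mono) auto
        then show "Nt * (sqrt q)\<^sup>2 \<le> real M" using M(2) q(1) by simp
        have "real K * real ns * q \<le> real K * real ns * (1 / (real K * real ns))" using q by (intro mult_left_mono) auto
        then show "real K * real ns * (sqrt q)\<^sup>2 \<le> 1" using q(1) by (simp split: if_splits)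
      qed
      then have "ennreal (c1 * q) \<le> ?V" using q(1) by simp
      moreover have "e * min (am Nt) (1 / (real K * real ns)) \<le> q"
        unfolding q_def
      proof (rule min.boundedI)
        have "e * min (am Nt) (1 / (real K * real ns)) \<le> 2 powr (- (2 * \<alpha>m)) * am Nt"
          using e by (intro mult_mono) (auto simp: am_def)
        also have "\<dots> \<le> real M powr - (2 * \<alpha>m)" using M(3) by (simp add: am_def)
        finally show "e * min (am Nt) (1 / (real K * real ns)) \<le> real M powr - (2 * \<alpha>m)" .
        have "e * min (am Nt) (1 / (real K * real ns)) \<le> 1 * (1 / (real K * real ns))"
          using e by (intro mult_mono) (auto simp: am_def)
        then show "e * min (am Nt) (1 / (real K * real ns)) \<le> 1 / (real K * real ns)" by simp
      qed
      ultimately show ?thesis by (rule scale)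
    qed

    \<comment> \<open>The largest of the four bounds, in the form that \<open>min_rate_le\<close>
      compares with the claimed rate.\<close>
    define t where "t = Max {1 / real nt, min (am Nt) ad, min (am Nt) (am Ns), min (am Nt) (1 / (real K * real ns))}"
    have "t \<in> {1 / real nt, min (am Nt) ad, min (am Nt) (am Ns), min (am Nt) (1 / (real K * real ns))}"
      unfolding t_def by (rule Max_in) auto
    then have Vt: "ennreal (c1 * e * t) \<le> ?V" using W1 W2 W3 W4 by auto
    have t: "1 / real nt \<le> t" "min (am Nt) ad \<le> t" "min (am Nt) (am Ns) \<le> t" "min (am Nt) (1 / (real K * real ns)) \<le> t"
      unfolding t_def by (intro Max_ge; simp)+
    have "0 \<le> t" using t(1) order_trans[of 0 "1 / real nt" t] by simp
    from min_rate_le[OF t(2-4,1) this \<Lambda>(1) _ \<Lambda>(2) _ \<Lambda>(3)]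
    have "c1 * e / (4 * \<Lambda>) * min (Lm powr (2 / (2 * \<alpha>m + 1)) * am Nt + 1 / real nt)
        (L\<delta> powr (2 / (2 * \<alpha>\<delta> + 1)) * ad + 1 / real nt + Lm powr (2 / (2 * \<alpha>m + 1)) * am Ns + 1 / (real K * real ns))
      \<le> c1 * e / (4 * \<Lambda>) * (4 * \<Lambda> * t)"
      using c1 e \<Lambda> by (intro mult_left_mono) auto
    also have "\<dots> = c1 * e * t" using \<Lambda> by simp
    finally show "ennreal (c1 * e / (4 * \<Lambda>) * min
           (Lm powr (2 / (2 * \<alpha>m + 1)) * (real mt * real nt) powr (- (2 * \<alpha>m) / (2 * \<alpha>m + 1))
              + 1 / real nt)
           (L\<delta> powr (2 / (2 * \<alpha>\<delta> + 1)) * (real mt * real nt) powr (- (2 * \<alpha>\<delta>) / (2 * \<alpha>\<delta> + 1))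
              + 1 / real nt
              + Lm powr (2 / (2 * \<alpha>m + 1)) * (real K * real ms * real ns) powr (- (2 * \<alpha>m) / (2 * \<alpha>m + 1))
              + 1 / (real K * real ns))) \<le> ?V"
      using Vt unfolding am_def ad_def Nt_def Ns_def by (meson ennreal_leI order_trans)
  qed
qed

end
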